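(* Let $n\geq 3$ be an odd integer. Then the following hold. (1) If $3\mid n$, then $$\mathrm{S}_{\mathrm{Dic}_{4n}}(3)=4n(n-1)(2n-5),\qquad \mathrm{D}_{\mathrm{Dic}_{4n}}(3)=\frac{2n(2n^2+3n-3)}{3},\qquad \mathrm{B}_{\mathrm{Dic}_{4n}}(3)=\frac{2n(2n^2+27n-25)}{3}.$$ (2) If $3\nmid n$, then $$\mathrm{S}_{\mathrm{Dic}_{4n}}(3)=4n(n-1)(2n-5),\qquad \mathrm{D}_{\mathrm{Dic}_{4n}}(3)=\frac{2n(n-1)(2n+5)}{3},\qquad \mathrm{B}_{\mathrm{Dic}_{4n}}(3)=\frac{2n(2n^2+27n-23)}{3}.$$
   Context: For a positive integer $n$, the dicyclic group is $\mathrm{Dic}_{4n}=\langle a,b : a^{2n}=1,\ a^{n}=b^2,\ b^{-1}ab=a^{-1}\rangle$, a group of order $4n$ with elements $1,a,\dots,a^{2n-1},b,ab,\dots,a^{2n-1}b$. For a subset $A$ of a finite (multiplicatively written) group, put $A+A=\{a_1a_2: a_1,a_2\in A\}$ and $A-A=\{a_1a_2^{-1}: a_1,a_2\in A\}$. The set $A$ is MSTD if $|A+A|>|A-A|$, balanced if $|A+A|=|A-A|$, and MDTS if $|A+A|<|A-A|$. For $k\in\mathbb{N}$, $\mathrm{S}_{\mathrm{Dic}_{4n}}(k)$, $\mathrm{D}_{\mathrm{Dic}_{4n}}(k)$, $\mathrm{B}_{\mathrm{Dic}_{4n}}(k)$ denote the numbers of MSTD, MDTS, and balanced subsets of $\mathrm{Dic}_{4n}$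 of cardinality $k$, respectively. *)

theory Defs
  imports Complex_Main "HOL-Algebra.Coset"
begin

text \<open>
  Groups given by generators and relations. A word is a list of letters \<open>(g, e)\<close>; the letter
  \<open>(g, True)\<close> stands for the generator \<open>g\<close> and \<open>(g, False)\<close> for its formal inverse.
  A relation \<open>r = s\<close> is the pair of words \<open>(r, s)\<close>.
\<close>

type_synonym 'g word = "('g \<times> bool) list"

inductive word_eq :: "('g word \<times> 'g word) set \<Rightarrow> 'g word \<Rightarrow> 'g word \<Rightarrow> bool"
  for R :: "('g word \<times> 'g word) set" where
  refl: "word_eq R u u"
| sym: "word_eq R u v \<Longrightarrow> word_eq R v u"
| trans: "word_eq R u v \<Longrightarrow> word_eq R v w \<Longrightarrow> word_eq R u w"
| cancel: "word_eq R (u @ [(g, e), (g, \<not> e)] @ v) (u @ v)"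
| relation: "(r, s) \<in> R \<Longrightarrow> word_eq R (u @ r @ v) (u @ s @ v)"

definition word_class :: "('g word \<times> 'g word) set \<Rightarrow> 'g word \<Rightarrow> 'g word set" where
  "word_class R u = {v. word_eq R u v}"

definition presented_group :: "('g word \<times> 'g word) set \<Rightarrow> 'g word set monoid" where
  "presented_group R =
    \<lparr>carrier = range (word_class R),
     monoid.mult = (\<lambda>C D. {w. \<exists>u\<in>C. \<exists>v\<in>D. word_eq R (u @ v) w}),
     one = word_class R []\<rparr>"

datatype dic_gen = gen_a | gen_b

definition dicyclic_relations :: "nat \<Rightarrow> (dic_gen word \<times> dic_gen word) set" where
  "dicyclic_relations n =
    {(replicate (2 * n) (gen_a, True), []),
     (replicate n (gen_a, True), [(gen_b, True), (gen_b, True)]),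
     ([(gen_b, False), (gen_a, True), (gen_b, True)], [(gen_a, False)])}"

text \<open>The group of order \<open>4 n\<close>: the parameter is \<open>n\<close>, not the order.\<close>

definition dicyclic_group :: "nat \<Rightarrow> dic_gen word set monoid" where
  "dicyclic_group n = presented_group (dicyclic_relations n)"

definition MSTD :: "('a, 'b) monoid_scheme \<Rightarrow> 'a set \<Rightarrow> bool" where
  "MSTD G A \<longleftrightarrow> card (A <#>\<^bsub>G\<^esub> A) > card (A <#>\<^bsub>G\<^esub> set_inv\<^bsub>G\<^esub> A)"

definition balanced :: "('a, 'b) monoid_scheme \<Rightarrow> 'a set \<Rightarrow> bool" where
  "balanced G A \<longleftrightarrow> card (A <#>\<^bsub>G\<^esub> A) = card (A <#>\<^bsub>G\<^esub> set_inv\<^bsub>G\<^esub> A)"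

definition MDTS :: "('a, 'b) monoid_scheme \<Rightarrow> 'a set \<Rightarrow> bool" where
  "MDTS G A \<longleftrightarrow> card (A <#>\<^bsub>G\<^esub> A) < card (A <#>\<^bsub>G\<^esub> set_inv\<^bsub>G\<^esub> A)"

definition num_MSTD :: "('a, 'b) monoid_scheme \<Rightarrow> nat \<Rightarrow> nat" where
  "num_MSTD G k = card {A. A \<subseteq> carrier G \<and> card A = k \<and> MSTD G A}"

definition num_MDTS :: "('a, 'b) monoid_scheme \<Rightarrow> nat \<Rightarrow> nat" where
  "num_MDTS G k = card {A. A \<subseteq> carrier G \<and> card A = k \<and> MDTS G A}"

definition num_balanced :: "('a, 'b) monoid_scheme \<Rightarrow> nat \<Rightarrow> nat" where
  "num_balanced G k = card {A. A \<subseteq> carrier G \<and> card A = k \<and> balanced G A}"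

end

theory Submission
  imports Defs "HOL-Computational_Algebra.Primes"
begin

text \<open>
  For \<open>n\<close> odd, write the elements of the dicyclic group as \<open>a\<^sup>i\<close> and \<open>a\<^sup>i b\<close> with \<open>i\<close> modulo \<open>2 n\<close>. That
  these \<open>4 n\<close> normal forms are distinct and exhaust the presented group is \<open>dic_model_iso\<close>: they
  form an explicit group which satisfies the relations.

  A subset \<open>A\<close> is given by its exponent sets \<open>X\<close> (elements \<open>a\<^sup>x\<close>) and \<open>Y\<close> (elements \<open>a\<^sup>y b\<close>). Since
  \<open>b a\<^sup>x = a\<^bsup>-x\<^esup> b\<close> and \<open>b\<^sup>2 = a\<^sup>n\<close>, the set \<open>A + A\<close> has exponents \<open>(X + X) \<union> (n + Y - Y)\<close> and
  \<open>(X + Y) \<union> (Y - X)\<close>, while \<open>A - A\<close> has exponents \<open>(X - X) \<union> (Y - Y)\<close> and \<open>(X + Y) \<union> (n + X + Y)\<close>.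
  For three elements there are four cases.

  \<^item> \<open>X = {x, y}\<close> and \<open>Y = {z}\<close>: the set is MSTD iff \<open>n\<close> divides none of \<open>x\<close>, \<open>y\<close>, \<open>x + y\<close>, and MDTS iff
    \<open>2 n\<close> divides \<open>x + y\<close> (\<open>mstd_iff_two_rotations\<close>, \<open>mdts_iff_two_rotations\<close>).
  \<^item> \<open>X = {x}\<close> and \<open>Y = {y, z}\<close>: the set is MSTD iff \<open>n\<close> divides none of \<open>x\<close> and \<open>2 x \<plusminus> (y - z)\<close>, and
    MDTS iff \<open>n\<close> divides \<open>x\<close> but not \<open>y - z\<close> (\<open>mstd_iff_two_reflections\<close>,
    \<open>mdts_iff_two_reflections\<close>).
  \<^item> \<open>Y\<close> empty: the set is balanced if \<open>X\<close> is an arithmetic progression modulo \<open>2 n\<close>, because then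
    \<open>X + X\<close> is a translate of \<open>X - X\<close>, and MDTS otherwise (\<open>mdts_rotations_iff\<close>).
  \<^item> \<open>X\<close> empty: the set is balanced (\<open>balanced_reflections\<close>).

  Oddness of \<open>n\<close> enters through the Chinese remainder theorem: a number is divisible by \<open>2 n\<close> iff it
  is even and divisible by \<open>n\<close>, so all coincidences can be discussed modulo \<open>n\<close> and modulo 2
  separately.

  Counting the solutions of the first two conditions is elementary. Progressions are counted by
  their midpoints: each \<open>y\<close> is the midpoint of \<open>n - 1\<close> of them, but the cosets of the subgroup of
  order 3, which exist only if 3 divides \<open>n\<close>, have three midpoints each. This is the source of
  the case distinction. The balanced sets are the remaining ones.
\<close>

section \<open>Groups given by generators and relations\<close>

lemma word_eq_context:
  "word_eq R u v \<Longrightarrow> word_eq R (p @ u @ q) (p @ v @ q)"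
proof (induction rule: word_eq.induct)
  case (cancel u g e v)
  then show ?case using word_eq.cancel[of R "p @ u" g e "v @ q"] by simp
next
  case (relation r s u v)
  then show ?case using word_eq.relation[of r s R "p @ u" "v @ q"] by simp
qed (auto intro: word_eq.intros)

lemma word_eq_append:
  assumes "word_eq R u u'" "word_eq R v v'"
  shows "word_eq R (u @ v) (u' @ v')"
  using word_eq_context[OF assms(1), of "[]" v] word_eq_context[OF assms(2), of u' "[]"]
  by (auto intro: word_eq.trans)

lemma word_class_eq_iff: "word_class R u = word_class R v \<longleftrightarrow> word_eq R u v"
  unfolding word_class_def by (auto intro: word_eq.intros)

lemma presented_mult:
  "word_class R u \<otimes>\<^bsub>presented_group R\<^esub> word_class R v = word_class R (u @ v)"
  by (auto simp: presented_group_def word_class_def intro: word_eq.intros word_eq_append)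

lemma presented_one: "\<one>\<^bsub>presented_group R\<^esub> = word_class R []"
  by (simp add: presented_group_def)

lemma presented_carrier: "carrier (presented_group R) = range (word_class R)"
  by (simp add: presented_group_def)

lemma word_eq_inverse:
  "word_eq R (rev (map (\<lambda>(g, e). (g, \<not> e)) u) @ u) []"
proof (induction u)
  case Nil
  then show ?case by (simp add: word_eq.refl)
next
  case (Cons l u)
  obtain g e where l: "l = (g, e)" by fastforce
  show ?case
    using word_eq.trans[OF word_eq.cancel[of R "rev (map (\<lambda>(g, e). (g, \<not> e)) u)" g "\<not> e" u] Cons]
    by (simp add: l)
qed

lemma group_presented: "group (presented_group R)"
proof (rule groupI)
  fix C assume "C \<in> carrier (presented_group R)"
  then obtain u where C: "C = word_class R u" by (auto simp: presented_carrier)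
  show "\<exists>D\<in>carrier (presented_group R). D \<otimes>\<^bsub>presented_group R\<^esub> C = \<one>\<^bsub>presented_group R\<^esub>"
    using word_eq_inverse[of R u]
    by (auto simp: C presented_carrier presented_mult presented_one word_class_eq_iff)
qed (auto simp: presented_carrier presented_mult presented_one)

definition eval_word :: "('h, 'm) monoid_scheme \<Rightarrow> ('g \<Rightarrow> 'h) \<Rightarrow> 'g word \<Rightarrow> 'h" where
  "eval_word H f w =
    foldr (\<lambda>(g, e) x. (if e then f g else inv\<^bsub>H\<^esub> f g) \<otimes>\<^bsub>H\<^esub> x) w \<one>\<^bsub>H\<^esub>"

context group begin

lemma eval_word_closed: "(\<And>g. f g \<in> carrier G) \<Longrightarrow> eval_word G f w \<in> carrier G"
  by (induction w) (auto simp: eval_word_def)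

lemma eval_word_append:
  "(\<And>g. f g \<in> carrier G) \<Longrightarrow> eval_word G f (u @ v) = eval_word G f u \<otimes> eval_word G f v"
proof (induction u)
  case Nil
  then show ?case using eval_word_closed[of f v] by (simp add: eval_word_def)
next
  case (Cons l u)
  then show ?case
    using eval_word_closed[of f u] eval_word_closed[of f v]
    by (auto simp: eval_word_def m_assoc split: prod.splits)
qed

lemma eval_word_respects:
  assumes "\<And>g. f g \<in> carrier G"
    and "\<And>r s. (r, s) \<in> R \<Longrightarrow> eval_word G f r = eval_word G f s"
    and "word_eq R u v"
  shows "eval_word G f u = eval_word G f v"
  using assms(3)
proof (induction rule: word_eq.induct)
  case (cancel u g e v)
  have "eval_word G f [(g, e), (g, \<not> e)] = \<one>" using assms(1) by (simp add: eval_word_def)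
  then show ?case
    using assms(1) eval_word_append[of f "[(g, e), (g, \<not> e)]" v]
    by (simp add: eval_word_append eval_word_closed)
next
  case (relation r s u v)
  then show ?case using assms(1,2) by (simp add: eval_word_append)
qed auto

text \<open>
  Von Dyck's theorem. Together with a model in which the relations hold, it is what separates
  elements of a presented group: equality of words can be derived from the relations,
  inequality only by mapping to a known group.
\<close>

lemma presented_group_lift:
  assumes "\<And>g. f g \<in> carrier G"
    and "\<And>r s. (r, s) \<in> R \<Longrightarrow> eval_word G f r = eval_word G f s"
  obtains h where "h \<in> hom (presented_group R) G"
    and "\<And>w. h (word_class R w) = eval_word G f w"
proof -
  \<comment> \<open>All words of one class have the same value, so the choice of the word is immaterial.\<close>
  define h where "h C = eval_word G f (SOME u. C = word_class R u)" for C
  have h: "h (word_class R w) = eval_word G f w" for w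
  proof -
    have "word_class R w = word_class R (SOME u. word_class R w = word_class R u)"
      by (rule someI) (rule HOL.refl)
    then show ?thesis
      unfolding h_def using eval_word_respects[OF assms]
      by (metis word_class_eq_iff)
  qed
  moreover have "h \<in> hom (presented_group R) G"
    using assms(1)
    by (auto simp: hom_def presented_carrier presented_mult h eval_word_append eval_word_closed)
  ultimately show ?thesis using that by blast
qed

end

section \<open>A model of the dicyclic group by residues modulo 2n\<close>

text \<open>
  The pair \<open>(i, e)\<close> stands for \<open>a\<^sup>i\<close> if \<open>e\<close> is false and for \<open>a\<^sup>i b\<close> if \<open>e\<close> is true. The
  product formula moves \<open>b\<close> to the right with \<open>b a\<^sup>j = a\<^bsup>-j\<^esup> b\<close> and replaces \<open>b\<^sup>2\<close> by \<open>a\<^sup>n\<close>.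
\<close>

definition dic_model :: "nat \<Rightarrow> (int \<times> bool) monoid" where
  "dic_model n =
    \<lparr>carrier = {0..<2 * int n} \<times> UNIV,
     monoid.mult = (\<lambda>(i, e) (j, f).
       ((i + (if e then - j else j) + (if e \<and> f then int n else 0)) mod (2 * int n), e \<noteq> f)),
     one = (0, False)\<rparr>"

lemma dic_model_carrier: "carrier (dic_model n) = {0..<2 * int n} \<times> UNIV"
  and dic_model_one: "\<one>\<^bsub>dic_model n\<^esub> = (0, False)"
  and dic_model_mult: "(i, e) \<otimes>\<^bsub>dic_model n\<^esub> (j, f) =
    ((i + (if e then - j else j) + (if e \<and> f then int n else 0)) mod (2 * int n), e \<noteq> f)"
  by (simp_all add: dic_model_def)

text \<open>
  The three shapes in which a reduced summand occurs when two products of the model are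
  composed.
\<close>

lemma mod_inner:
  fixes c d x m :: int
  shows "(x mod m + c + d) mod m = (x + c + d) mod m"
    and "(c + x mod m + d) mod m = (c + x + d) mod m"
    and "(c + - (x mod m) + d) mod m = (c - x + d) mod m"
proof -
  show "(x mod m + c + d) mod m = (x + c + d) mod m"
    by (metis mod_add_left_eq add.assoc)
  show "(c + x mod m + d) mod m = (c + x + d) mod m"
    by (metis mod_add_left_eq mod_add_right_eq)
  show "(c + - (x mod m) + d) mod m = (c - x + d) mod m"
    using mod_add_left_eq[of "c - x mod m" m d] mod_add_left_eq[of "c - x" m d] mod_diff_right_eq[of c x m]
    by simp
qed

lemma mod_cancel_shift: "((i + m) mod (2 * m) - i + m) mod (2 * m) = (0::int)"
  using mod_inner(1)[of "i + m" "2 * m" "- i" m] by simp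

lemma group_dic_model:
  assumes "n > 0"
  shows "group (dic_model n)"
proof (rule groupI)
  fix x assume x: "x \<in> carrier (dic_model n)"
  obtain i e where [simp]: "x = (i, e)" by fastforce
  have "(if e then ((i + int n) mod (2 * int n), True) else (- i mod (2 * int n), False))
      \<in> carrier (dic_model n)"
    using assms by (simp add: dic_model_carrier)
  moreover have "(if e then ((i + int n) mod (2 * int n), True) else (- i mod (2 * int n), False))
      \<otimes>\<^bsub>dic_model n\<^esub> x = \<one>\<^bsub>dic_model n\<^esub>"
    using mod_cancel_shift[of i "int n"] by (simp add: dic_model_mult dic_model_one mod_simps)
  ultimately show "\<exists>y\<in>carrier (dic_model n). y \<otimes>\<^bsub>dic_model n\<^esub> x = \<one>\<^bsub>dic_model n\<^esub>" by blast
next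
  fix x y z :: "int \<times> bool"
  obtain i e where x: "x = (i, e)" by fastforce
  obtain j f where y: "y = (j, f)" by fastforce
  obtain k g where z: "z = (k, g)" by fastforce
  show "x \<otimes>\<^bsub>dic_model n\<^esub> y \<otimes>\<^bsub>dic_model n\<^esub> z = x \<otimes>\<^bsub>dic_model n\<^esub> (y \<otimes>\<^bsub>dic_model n\<^esub> z)"
    by (cases e; cases f; cases g;
        simp only: dic_model_mult prod.case simp_thms if_True if_False mod_inner x y z;
        simp add: mod_eq_dvd_iff)
qed (use assms in \<open>auto simp: dic_model_carrier dic_model_one dic_model_mult\<close>)

lemma inv_dic_model:
  assumes "n > 0" "i \<in> {0..<2 * int n}"
  shows "inv\<^bsub>dic_model n\<^esub> (i, False) = (- i mod (2 * int n), False)"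
    and "inv\<^bsub>dic_model n\<^esub> (i, True) = ((i + int n) mod (2 * int n), True)"
  by (rule group.inv_equality[OF group_dic_model[OF assms(1)]];
      use assms mod_cancel_shift[of i "int n"] in
      \<open>simp add: dic_model_carrier dic_model_one dic_model_mult mod_simps\<close>)+

context group begin

context
  fixes a b and n :: nat
  assumes carr: "a \<in> carrier G" "b \<in> carrier G"
    and rel1: "a [^] (2 * n) = \<one>"
    and rel2: "a [^] n = b \<otimes> b"
    and rel3: "inv b \<otimes> a \<otimes> b = inv a"
begin

lemma b_pow_a: "b \<otimes> a [^] (i::int) = a [^] (- i) \<otimes> b"
proof -
  have swap: "b \<otimes> inv x = x \<otimes> b" if "x \<in> carrier G" "b \<otimes> x = inv x \<otimes> b" for x
  proof -
    have "x \<otimes> (inv x \<otimes> b) \<otimes> inv x = b \<otimes> inv x"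
      using that(1) carr by (simp add: m_assoc[symmetric])
    moreover have "x \<otimes> (b \<otimes> x) \<otimes> inv x = x \<otimes> b" using that(1) carr by (simp add: m_assoc)
    ultimately show ?thesis using that(2) by simp
  qed
  have "b \<otimes> (inv b \<otimes> a \<otimes> b) = a \<otimes> b" using carr by (simp add: m_assoc[symmetric])
  then have "b \<otimes> inv a = inv (inv a) \<otimes> b" using carr rel3 by simp
  then have ba: "b \<otimes> a = inv a \<otimes> b" using swap[of "inv a"] carr by simp
  have nat: "b \<otimes> a [^] (k::nat) = inv (a [^] k) \<otimes> b" for k
  proof (induction k)
    case (Suc k)
    have "b \<otimes> a [^] Suc k = inv (a [^] k) \<otimes> (b \<otimes> a)"
      using carr Suc by (simp add: m_assoc[symmetric])
    also have "\<dots> = (inv (a [^] k) \<otimes> inv a) \<otimes> b" using carr ba by (simp add: m_assoc)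
    also have "inv (a [^] k) \<otimes> inv a = inv (a [^] Suc k)"
      using carr by (simp only: inv_mult_group[symmetric] nat_pow_closed nat_pow_Suc2[symmetric])
    finally show ?case .
  qed (use carr in simp)
  show ?thesis
  proof (cases i rule: int_cases2)
    case (nonneg k)
    then show ?thesis using nat[of k] carr by (simp add: int_pow_int int_pow_neg)
  next
    case (nonpos k)
    then show ?thesis using swap[OF _ nat[of k]] carr by (simp add: int_pow_int int_pow_neg)
  qed
qed

lemma a_pow_mod: "a [^] (i mod (2 * int n)) = a [^] (i::int)"
proof -
  have "a [^] i = a [^] (2 * int n * (i div (2 * int n)) + i mod (2 * int n))" by simp
  also have "\<dots> = (a [^] (2 * int n)) [^] (i div (2 * int n)) \<otimes> a [^] (i mod (2 * int n))"
    using carr by (simp only: int_pow_mult int_pow_pow)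
  also have "a [^] (2 * int n) = \<one>" using rel1 int_pow_int[of G a "2 * n"] by simp
  finally show ?thesis using carr by simp
qed

text \<open>
  Every pair \<open>a\<close>, \<open>b\<close> in a group that satisfies the dicyclic relations yields a homomorphic image
  of the model; this is the normal form computation \<open>a\<^sup>i b\<^sup>e a\<^sup>j b\<^sup>f = a\<^bsup>i \<plusminus> j (+ n)\<^esup> b\<^bsup>e + f\<^esup>\<close>.
\<close>

lemma dic_model_hom:
  "(\<lambda>(i, e). a [^] i \<otimes> (if e then b else \<one>)) \<in> hom (dic_model n) G"
proof (rule homI; clarify)
  fix i j :: int and e f
  have bb: "b \<otimes> b = a [^] int n" using rel2 by (simp add: int_pow_int)
  have aa: "a [^] k \<otimes> (a [^] l \<otimes> z) = a [^] (k + l) \<otimes> z" if "z \<in> carrier G" for k l :: int and z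
    using that carr by (simp add: m_assoc[symmetric] int_pow_mult)
  have ba: "b \<otimes> (a [^] k \<otimes> z) = a [^] (- k) \<otimes> (b \<otimes> z)" if "z \<in> carrier G" for k :: int and z
    using that carr by (simp add: m_assoc[symmetric] b_pow_a)
  show "(case (i, e) \<otimes>\<^bsub>dic_model n\<^esub> (j, f) of (i, e) \<Rightarrow> a [^] i \<otimes> (if e then b else \<one>)) =
    a [^] i \<otimes> (if e then b else \<one>) \<otimes> (a [^] j \<otimes> (if f then b else \<one>))"
    using carr
    by (cases e; cases f) (simp_all add: dic_model_mult a_pow_mod
        a_pow_mod[unfolded mult.commute[of "2::int"]] m_assoc aa ba bb b_pow_a int_pow_mult[symmetric] algebra_simps)
qed (use carr in auto)

end
end

text \<open>
  The normal form map \<open>(i, e) \<mapsto> a\<^sup>i b\<^sup>e\<close> is onto because its image is a subgroup that contains both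
  generators. It is injective because the lift of \<open>a \<mapsto> (1, False)\<close>, \<open>b \<mapsto> (0, True)\<close>, which exists as
  the model satisfies the relations, is a left inverse.
\<close>

lemma dic_model_iso:
  assumes n: "n > 0"
  shows "\<exists>h. h \<in> iso (dic_model n) (dicyclic_group n)"
proof -
  let ?R = "dicyclic_relations n" and ?D = "dicyclic_group n" and ?M = "dic_model n"
  interpret D: group ?D unfolding dicyclic_group_def by (rule group_presented)
  interpret M: group ?M using n by (rule group_dic_model)
  define a where "a = word_class ?R [(gen_a, True)]"
  define b where "b = word_class ?R [(gen_b, True)]"
  have carr: "a \<in> carrier ?D" "b \<in> carrier ?D"
    by (auto simp: a_def b_def dicyclic_group_def presented_carrier)
  have a_pow: "a [^]\<^bsub>?D\<^esub> (k::nat) = word_class ?R (replicate k (gen_a, True))" for k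
    by (induction k)
       (auto simp: a_def dicyclic_group_def presented_mult presented_one replicate_append_same)
  have letter_inv: "inv\<^bsub>?D\<^esub> (word_class ?R [(g, True)]) = word_class ?R [(g, False)]" for g
    using word_eq.cancel[of ?R "[]" g False "[]"]
    by (intro D.inv_equality)
       (auto simp: dicyclic_group_def presented_mult presented_one presented_carrier word_class_eq_iff)
  have rel: "word_class ?R r = word_class ?R s" if "(r, s) \<in> ?R" for r s
    using word_eq.relation[OF that, of "[]" "[]"] by (simp add: word_class_eq_iff)
  have rel1: "a [^]\<^bsub>?D\<^esub> (2 * n) = \<one>\<^bsub>?D\<^esub>"
    unfolding a_pow
    by (simp add: dicyclic_group_def presented_one)
       (rule rel, simp add: dicyclic_relations_def)
  have rel2: "a [^]\<^bsub>?D\<^esub> n = b \<otimes>\<^bsub>?D\<^esub> b"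
    unfolding a_pow b_def
    by (simp add: dicyclic_group_def presented_mult)
       (rule rel, simp add: dicyclic_relations_def)
  have rel3: "inv\<^bsub>?D\<^esub> b \<otimes>\<^bsub>?D\<^esub> a \<otimes>\<^bsub>?D\<^esub> b = inv\<^bsub>?D\<^esub> a"
    unfolding a_def b_def letter_inv
    by (simp add: dicyclic_group_def presented_mult)
       (rule rel, simp add: dicyclic_relations_def)
  define h where "h = (\<lambda>(i, e). a [^]\<^bsub>?D\<^esub> (i::int) \<otimes>\<^bsub>?D\<^esub> (if e then b else \<one>\<^bsub>?D\<^esub>))"
  have h: "h \<in> hom ?M ?D"
    unfolding h_def by (rule D.dic_model_hom[OF carr rel1 rel2 rel3])
  interpret h: group_hom ?M ?D h by unfold_locales (rule h)
  have img: "subgroup (h ` carrier ?M) ?D" by (rule h.img_is_subgroup)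
  have "a = h (1, False)" "b = h (0, True)" using carr by (simp_all add: h_def)
  then have gens: "word_class ?R [(g, True)] \<in> h ` carrier ?M" for g
    using n by (cases g) (auto simp: dic_model_carrier a_def b_def)
  have letters: "word_class ?R [(g, e)] \<in> h ` carrier ?M" for g e
    using gens[of g] subgroup.m_inv_closed[OF img gens[of g]] letter_inv[of g] by (cases e) auto
  have "word_class ?R w \<in> h ` carrier ?M" for w
  proof (induction w)
    case Nil
    then show ?case
      using subgroup.one_closed[OF img] by (simp add: dicyclic_group_def presented_one)
  next
    case (Cons l w)
    then show ?case
      using subgroup.m_closed[OF img letters[of "fst l" "snd l"] Cons]
      by (simp add: dicyclic_group_def presented_mult)
  qed
  then have surj: "h ` carrier ?M = carrier ?D"
    using subgroup.subset[OF img] by (auto simp: dicyclic_group_def presented_carrier)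
  define f where "f g = (if g = gen_a then (1, False) else (0::int, True))" for g
  have f: "f g \<in> carrier ?M" for g using n by (auto simp: f_def dic_model_carrier)
  have ev_pow: "eval_word ?M f (replicate k (gen_a, True)) = (int k mod (2 * int n), False)" for k
    by (induction k) (auto simp: eval_word_def f_def dic_model_mult dic_model_one mod_simps)
  have "eval_word ?M f r = eval_word ?M f s" if "(r, s) \<in> ?R" for r s
    using that n
    by (auto simp: dicyclic_relations_def ev_pow)
       (auto simp: eval_word_def f_def dic_model_mult dic_model_one inv_dic_model mod_simps)
  then obtain k where k: "k \<in> hom (presented_group ?R) ?M"
    and kw: "\<And>w. k (word_class ?R w) = eval_word ?M f w"
    using M.presented_group_lift[of f ?R] f by blast
  have kk: "k (h p) = p" if "p \<in> carrier ?M" for p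
  proof -
    obtain i e where p: "p = (i, e)" by fastforce
    with that have i: "0 \<le> i" "i < 2 * int n" by (auto simp: dic_model_carrier)
    have "h p = word_class ?R (replicate (nat i) (gen_a, True) @ (if e then [(gen_b, True)] else []))"
      using i a_pow[of "nat i"] int_pow_int[of ?D a "nat i"]
      by (simp add: h_def p b_def) (simp add: dicyclic_group_def presented_mult presented_one)
    then have "k (h p) = (i mod (2 * int n), False) \<otimes>\<^bsub>?M\<^esub> (if e then (0, True) else (0, False))"
      using i f by (simp add: kw M.eval_word_append ev_pow)
         (simp add: eval_word_def f_def dic_model_mult dic_model_one)
    then show ?thesis using i by (simp add: p dic_model_mult)
  qed
  have "inj_on h (carrier ?M)" by (rule inj_on_inverseI[of _ k]) (rule kk)
  then have "h \<in> iso ?M ?D" using h surj by (simp add: iso_def bij_betw_def)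
  then show ?thesis by blast
qed

section \<open>Invariance of the counts under isomorphism\<close>

lemma
  assumes G: "group G" and H: "group H" and h: "h \<in> iso G H" and A: "A \<subseteq> carrier G"
  shows card_set_mult_iso: "card (h ` A <#>\<^bsub>H\<^esub> h ` A) = card (A <#>\<^bsub>G\<^esub> A)"
    and card_set_diff_iso:
      "card (h ` A <#>\<^bsub>H\<^esub> set_inv\<^bsub>H\<^esub> (h ` A)) = card (A <#>\<^bsub>G\<^esub> set_inv\<^bsub>G\<^esub> A)"
proof -
  interpret h: group_hom G H h
    using G H h by (simp add: group_hom_def group_hom_axioms_def iso_def)
  have inj: "inj_on h (carrier G)" using h by (auto simp: iso_def bij_betw_def)
  have prod: "h ` B <#>\<^bsub>H\<^esub> h ` C = h ` (B <#>\<^bsub>G\<^esub> C)"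
    if "B \<subseteq> carrier G" "C \<subseteq> carrier G" for B C
    using that unfolding set_mult_def by (force simp: subset_iff)
  have invs: "set_inv\<^bsub>H\<^esub> (h ` A) = h ` (set_inv\<^bsub>G\<^esub> A)"
    using A unfolding SET_INV_def by (force simp: subset_iff)
  have sub: "set_inv\<^bsub>G\<^esub> A \<subseteq> carrier G" using A by (auto simp: SET_INV_def)
  have card: "card (h ` B) = card B" if "B \<subseteq> carrier G" for B
    using that inj by (intro card_image) (rule inj_on_subset)
  show "card (h ` A <#>\<^bsub>H\<^esub> h ` A) = card (A <#>\<^bsub>G\<^esub> A)"
    using A by (simp add: prod card monoid.set_mult_closed[OF group.is_monoid[OF G]])
  show "card (h ` A <#>\<^bsub>H\<^esub> set_inv\<^bsub>H\<^esub> (h ` A)) = card (A <#>\<^bsub>G\<^esub> set_inv\<^bsub>G\<^esub> A)"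
    using A sub by (simp add: invs prod card monoid.set_mult_closed[OF group.is_monoid[OF G]])
qed

lemma card_subsets_iso:
  assumes h: "bij_betw h (carrier G) (carrier H)"
    and PQ: "\<And>A. A \<subseteq> carrier G \<Longrightarrow> Q (h ` A) \<longleftrightarrow> P A"
  shows "card {A. A \<subseteq> carrier G \<and> card A = k \<and> P A} = card {A. A \<subseteq> carrier H \<and> card A = k \<and> Q A}"
proof -
  have inj: "inj_on h (carrier G)" and im: "h ` carrier G = carrier H"
    and hH: "\<And>x. x \<in> carrier G \<Longrightarrow> h x \<in> carrier H"
    using h by (auto simp: bij_betw_def)
  have ca: "card (h ` A) = card A" if "A \<subseteq> carrier G" for A
    using inj_on_subset[OF inj that] by (rule card_image)
  have "bij_betw ((`) h) {A. A \<subseteq> carrier G \<and> card A = k \<and> P A}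
      {A. A \<subseteq> carrier H \<and> card A = k \<and> Q A}"
    unfolding bij_betw_def
  proof (intro conjI equalityI subsetI)
    show "inj_on ((`) h) {A. A \<subseteq> carrier G \<and> card A = k \<and> P A}"
      by (rule inj_on_subset[OF inj_on_image_Pow[OF inj]]) auto
  next
    fix B assume "B \<in> (`) h ` {A. A \<subseteq> carrier G \<and> card A = k \<and> P A}"
    then show "B \<in> {A. A \<subseteq> carrier H \<and> card A = k \<and> Q A}" using hH ca PQ by (auto simp: subset_iff)
  next
    fix B assume B: "B \<in> {A. A \<subseteq> carrier H \<and> card A = k \<and> Q A}"
    then obtain A where "A \<subseteq> carrier G" "B = h ` A" using im by (metis (lifting) mem_Collect_eq subset_imageE)
    then show "B \<in> (`) h ` {A. A \<subseteq> carrier G \<and> card A = k \<and> P A}" using B ca PQ by auto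
  qed
  then show ?thesis by (rule bij_betw_same_card)
qed

lemma
  assumes "group G" "group H" "h \<in> iso G H"
  shows num_MSTD_iso: "num_MSTD G k = num_MSTD H k"
    and num_MDTS_iso: "num_MDTS G k = num_MDTS H k"
    and num_balanced_iso: "num_balanced G k = num_balanced H k"
  unfolding num_MSTD_def num_MDTS_def num_balanced_def
  using assms
  by (intro card_subsets_iso[of h];
      simp add: iso_def MSTD_def MDTS_def balanced_def card_set_mult_iso card_set_diff_iso)+

section \<open>Products and quotients as residue sets\<close>

definition num_residues :: "int \<Rightarrow> int set \<Rightarrow> nat" where
  "num_residues N S = card ((\<lambda>i. i mod N) ` S)"

definition sumset :: "int set \<Rightarrow> int set \<Rightarrow> int set" where
  "sumset X Y = (\<Union>x\<in>X. \<Union>y\<in>Y. {x + y})"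

definition diffset :: "int set \<Rightarrow> int set \<Rightarrow> int set" where
  "diffset X Y = (\<Union>x\<in>X. \<Union>y\<in>Y. {x - y})"

lemma num_residues_empty [simp]: "num_residues N {} = 0"
  by (simp add: num_residues_def)

lemma num_residues_insert [simp]:
  "finite S \<Longrightarrow> num_residues N (insert a S) =
    (if \<exists>s\<in>S. N dvd a - s then num_residues N S else Suc (num_residues N S))"
  by (auto simp: num_residues_def card_insert_if mod_eq_dvd_iff)

lemma num_residues_shift: "num_residues N ((+) c ` S) = num_residues N S"
proof -
  have "(\<lambda>i. i mod N) ` (+) c ` S = (\<lambda>i. (c + i) mod N) ` (\<lambda>i. i mod N) ` S"
    by (simp add: image_image mod_simps)
  moreover have "inj_on (\<lambda>i. (c + i) mod N) ((\<lambda>i. i mod N) ` S)"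
  proof (rule inj_onI, clarify)
    fix i j assume "(c + i mod N) mod N = (c + j mod N) mod N"
    then have "(c + i) mod N = (c + j) mod N" by (simp add: mod_simps)
    then show "i mod N = j mod N" by (simp add: mod_eq_dvd_iff)
  qed
  ultimately show ?thesis by (simp add: num_residues_def card_image)
qed

lemma card_avoid_residues:
  assumes "N > 0" "finite S"
  shows "card {z \<in> {0..<N}. \<forall>s\<in>S. \<not> N dvd z - s} = nat N - num_residues N S"
proof -
  have "{z \<in> {0..<N}. \<forall>s\<in>S. \<not> N dvd z - s} = {0..<N} - (\<lambda>i. i mod N) ` S"
    by (auto simp: image_iff simp flip: mod_eq_dvd_iff)
  moreover have "(\<lambda>i. i mod N) ` S \<subseteq> {0..<N}" using assms(1) by auto
  ultimately show ?thesis
    by (simp add: num_residues_def card_Diff_subset assms(2))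
qed

definition dic_set :: "int set \<Rightarrow> int set \<Rightarrow> (int \<times> bool) set" where
  "dic_set X Y = X \<times> {False} \<union> Y \<times> {True}"

lemma card_dic_set: "finite X \<Longrightarrow> finite Y \<Longrightarrow> card (dic_set X Y) = card X + card Y"
  unfolding dic_set_def by (subst card_Un_disjoint) auto

lemma UN_dic_set: "(\<Union>p\<in>dic_set X Y. f p) = (\<Union>x\<in>X. f (x, False)) \<union> (\<Union>y\<in>Y. f (y, True))"
  by (auto simp: dic_set_def)

lemma dic_set_image: "dic_set X Y = (\<lambda>x. (x, False)) ` X \<union> (\<lambda>y. (y, True)) ` Y"
  by (auto simp: dic_set_def)

lemma sumset_commute: "sumset X Y = sumset Y X"
  unfolding sumset_def by (auto simp: add.commute)

lemma dic_model_mult_cases: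
  "(i, False) \<otimes>\<^bsub>dic_model n\<^esub> (j, False) = ((i + j) mod (2 * int n), False)"
  "(i, False) \<otimes>\<^bsub>dic_model n\<^esub> (j, True) = ((i + j) mod (2 * int n), True)"
  "(i, True) \<otimes>\<^bsub>dic_model n\<^esub> (j, False) = ((i - j) mod (2 * int n), True)"
  "(i, True) \<otimes>\<^bsub>dic_model n\<^esub> (j, True) = ((int n + (i - j)) mod (2 * int n), False)"
  by (simp_all add: dic_model_mult algebra_simps)

text \<open>
  The second factors are the inverses of \<open>(j, False)\<close> and of \<open>(j, True)\<close>.
\<close>

lemma dic_model_mult_inv_cases:
  "(i, False) \<otimes>\<^bsub>dic_model n\<^esub> (- j mod (2 * int n), False) = ((i - j) mod (2 * int n), False)"
  "(i, False) \<otimes>\<^bsub>dic_model n\<^esub> ((j + int n) mod (2 * int n), True) =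
    ((int n + (i + j)) mod (2 * int n), True)"
  "(j, True) \<otimes>\<^bsub>dic_model n\<^esub> (- i mod (2 * int n), False) = ((j + i) mod (2 * int n), True)"
  "(i, True) \<otimes>\<^bsub>dic_model n\<^esub> ((j + int n) mod (2 * int n), True) =
    ((i - j) mod (2 * int n), False)"
  using mod_inner(3)[of j "- i" "2 * int n" 0] mod_inner(3)[of i "j + int n" "2 * int n" "int n"]
  by (simp_all add: dic_model_mult mod_simps add_ac)

lemma card_set_mult_dic_set:
  assumes "finite X" "finite Y"
  shows "card (dic_set X Y <#>\<^bsub>dic_model n\<^esub> dic_set X Y) =
    num_residues (2 * int n) (sumset X X \<union> (+) (int n) ` diffset Y Y) +
    num_residues (2 * int n) (sumset X Y \<union> diffset Y X)"
proof -
  have "dic_set X Y <#>\<^bsub>dic_model n\<^esub> dic_set X Y =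
    dic_set ((\<lambda>i. i mod (2 * int n)) ` (sumset X X \<union> (+) (int n) ` diffset Y Y))
      ((\<lambda>i. i mod (2 * int n)) ` (sumset X Y \<union> diffset Y X))" (is "?L = ?R")
    unfolding set_mult_def UN_dic_set dic_model_mult_cases
    by (simp add: dic_set_image sumset_def diffset_def image_Un image_UN image_image UN_Un_distrib Un_ac)
  then show ?thesis
    using assms by (simp add: card_dic_set num_residues_def sumset_def diffset_def)
qed

lemma card_set_diff_dic_set:
  assumes n: "n > 0" and X: "X \<subseteq> {0..<2 * int n}" and Y: "Y \<subseteq> {0..<2 * int n}"
  shows "card (dic_set X Y <#>\<^bsub>dic_model n\<^esub> set_inv\<^bsub>dic_model n\<^esub> (dic_set X Y)) =
    num_residues (2 * int n) (diffset X X \<union> diffset Y Y) +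
    num_residues (2 * int n) (sumset X Y \<union> (+) (int n) ` sumset X Y)"
proof -
  have fin: "finite X" "finite Y" using X Y finite_subset by blast+
  have "set_inv\<^bsub>dic_model n\<^esub> (dic_set X Y) =
      dic_set ((\<lambda>x. - x mod (2 * int n)) ` X) ((\<lambda>y. (y + int n) mod (2 * int n)) ` Y)"
    using X Y n by (force simp: SET_INV_def dic_set_def inv_dic_model subset_iff)
  moreover have "dic_set X Y <#>\<^bsub>dic_model n\<^esub>
      dic_set ((\<lambda>x. - x mod (2 * int n)) ` X) ((\<lambda>y. (y + int n) mod (2 * int n)) ` Y) =
    dic_set ((\<lambda>i. i mod (2 * int n)) ` (diffset X X \<union> diffset Y Y))
      ((\<lambda>i. i mod (2 * int n)) ` (sumset Y X \<union> (+) (int n) ` sumset X Y))" (is "?L = ?R")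
    unfolding set_mult_def UN_dic_set UN_simps(10) dic_model_mult_inv_cases
    by (simp add: dic_set_image sumset_def diffset_def image_Un image_UN image_image UN_Un_distrib Un_ac)
  ultimately show ?thesis
    using fin by (simp add: card_dic_set num_residues_def sumset_def diffset_def
        sumset_commute[of Y X, unfolded sumset_def])
qed

text \<open>
  If reflection in \<open>c / 2\<close> permutes the residues of \<open>X\<close>, then \<open>X\<close> and \<open>c - X\<close> agree modulo \<open>N\<close>, so that
  \<open>X + X\<close> is a translate of \<open>X - X\<close>.
\<close>

lemma num_residues_sumset_symmetric:
  assumes "\<And>x. x \<in> X \<Longrightarrow> \<exists>x'\<in>X. N dvd x + x' - c"
  shows "num_residues N (sumset X X) = num_residues N (diffset X X)"
proof -
  have sub: "(u + x) mod N \<in> (\<lambda>i. i mod N) ` (+) c ` diffset X X" if "u \<in> X" "x \<in> X" for u x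
  proof -
    obtain x' where "x' \<in> X" "N dvd x + x' - c" using assms \<open>x \<in> X\<close> by blast
    then have "(u + x) mod N = (c + (u - x')) mod N" by (simp add: mod_eq_dvd_iff algebra_simps)
    then show ?thesis using \<open>u \<in> X\<close> \<open>x' \<in> X\<close> by (auto simp: diffset_def)
  qed
  have sup: "(c + (u - x)) mod N \<in> (\<lambda>i. i mod N) ` sumset X X" if "u \<in> X" "x \<in> X" for u x
  proof -
    obtain x' where "x' \<in> X" "N dvd x + x' - c" using assms \<open>x \<in> X\<close> by blast
    then have "(u + x') mod N = (c + (u - x)) mod N" by (simp add: mod_eq_dvd_iff algebra_simps)
    then show ?thesis using \<open>u \<in> X\<close> \<open>x' \<in> X\<close> unfolding sumset_def by (metis (no_types, lifting) UN_I image_eqI singletonI)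
  qed
  have "(\<lambda>i. i mod N) ` sumset X X = (\<lambda>i. i mod N) ` (+) c ` diffset X X"
  proof (intro equalityI subsetI)
    fix r assume "r \<in> (\<lambda>i. i mod N) ` sumset X X"
    then show "r \<in> (\<lambda>i. i mod N) ` (+) c ` diffset X X" using sub by (auto simp: sumset_def)
  next
    fix r assume "r \<in> (\<lambda>i. i mod N) ` (+) c ` diffset X X"
    then show "r \<in> (\<lambda>i. i mod N) ` sumset X X" using sup by (auto simp: diffset_def)
  qed
  then show ?thesis using num_residues_shift[of N c "diffset X X"] by (simp add: num_residues_def)
qed

text \<open>
  For use with \<open>simp only\<close>: these rules count the residues of an explicit list without normalizing
  the pairwise differences, so that facts about the differences apply as they are stated.
\<close>

lemmas num_residues_simps =
  num_residues_insert finite.emptyI finite.insertI num_residues_empty bex_empty bex_simps(5)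
  simp_thms if_True if_False

text \<open>
  The sizes of \<open>A + A\<close> and \<open>A - A\<close> for the set \<open>A\<close> of all \<open>a\<^sup>x\<close> and \<open>a\<^sup>y b\<close> with \<open>x \<in> X\<close> and \<open>y \<in> Y\<close>
  (see \<open>card_set_mult_dic_set\<close> and \<open>card_set_diff_dic_set\<close>): the first summand counts the
  powers of \<open>a\<close>, the second one the elements outside \<open>\<langle>a\<rangle>\<close>.
\<close>

definition product_size :: "int \<Rightarrow> int set \<Rightarrow> int set \<Rightarrow> nat" where
  "product_size m X Y = num_residues (2 * m) (sumset X X \<union> (+) m ` diffset Y Y) +
    num_residues (2 * m) (sumset X Y \<union> diffset Y X)"

definition quotient_size :: "int \<Rightarrow> int set \<Rightarrow> int set \<Rightarrow> nat" where
  "quotient_size m X Y = num_residues (2 * m) (diffset X X \<union> diffset Y Y) +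
    num_residues (2 * m) (sumset X Y \<union> (+) m ` sumset X Y)"

lemma dvd_iff_of_dvd_diff: "k dvd a - b \<Longrightarrow> k dvd a \<longleftrightarrow> k dvd b" for k a b :: int
  using dvd_add_left_iff[of k "a - b" b] by (simp add: dvd_add_right_iff)

section \<open>Comparison of the two sizes for sets of three elements\<close>

locale odd_modulus =
  fixes m :: int
  assumes m3: "m \<ge> 3" and odd_m: "odd m"
begin

text \<open>
  The Chinese remainder theorem for \<open>2 m\<close>. It turns every coincidence between two products
  into a divisibility by \<open>m\<close> and a parity condition.
\<close>

lemma dvd_split: "2 * m dvd e \<longleftrightarrow> m dvd e \<and> even e"
proof
  assume e: "m dvd e \<and> even e"
  have "coprime 2 m" using odd_m by (simp add: coprime_left_2_iff_odd)
  then show "2 * m dvd e" using e by (simp add: divides_mult)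
qed (auto dest: dvd_mult_left dvd_mult_right)

lemma dvd_double: "m dvd 2 * e \<longleftrightarrow> m dvd e"
  using odd_m by (simp add: coprime_dvd_mult_right_iff coprime_right_2_iff_odd)

lemma dvd_shift: "2 * m dvd e - m \<longleftrightarrow> m dvd e \<and> odd e"
proof -
  have "m dvd e - m \<longleftrightarrow> m dvd e" by (metis diff_add_cancel dvd_add_triv_right_iff)
  then show ?thesis using odd_m by (simp add: dvd_split)
qed

lemma dvd_cases: "m dvd e \<longleftrightarrow> 2 * m dvd e \<or> 2 * m dvd e - m"
  unfolding dvd_shift unfolding dvd_split by auto

lemma dvd_twice: "2 * m dvd 2 * e \<longleftrightarrow> m dvd e"
  by simp

text \<open>
  For \<open>A = {a\<^sup>x, a\<^sup>y, a\<^sup>z b}\<close> the generic sizes are 8 for the products and 7 for the quotients. Each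
  residue set is listed below and its coincidences are read off from the pairwise differences.
  The square of \<open>a\<^sup>z b\<close> is \<open>a\<^sup>m\<close>, which can equal \<open>a\<^bsup>x + y\<^esup>\<close> but, \<open>m\<close> being odd, neither \<open>a\<^bsup>2 x\<^esup>\<close>
  nor \<open>a\<^bsup>2 y\<^esup>\<close>.
\<close>

lemma
  assumes xy: "\<not> 2 * m dvd x - y"
  shows mstd_iff_two_rotations: "quotient_size m {x, y} {z} < product_size m {x, y} {z} \<longleftrightarrow>
      \<not> m dvd x \<and> \<not> m dvd y \<and> \<not> m dvd x + y"
    and mdts_iff_two_rotations: "product_size m {x, y} {z} < quotient_size m {x, y} {z} \<longleftrightarrow> 2 * m dvd x + y"
proof -
  have [simp]: "2 * m dvd y - x \<longleftrightarrow> 2 * m dvd x - y" "m dvd y - x \<longleftrightarrow> m dvd x - y"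
    using dvd_minus_iff[of _ "x - y"] by simp_all
  have e1: "sumset {x, y} {x, y} \<union> (+) m ` diffset {z} {z} = {x + x, x + y, y + y, m}"
    and e2: "sumset {x, y} {z} \<union> diffset {z} {x, y} = {x + z, y + z, z - x, z - y}"
    and e3: "diffset {x, y} {x, y} \<union> diffset {z} {z} = {0, x - y, y - x}"
    and e4: "sumset {x, y} {z} \<union> (+) m ` sumset {x, y} {z} =
      {x + z, y + z, m + (x + z), m + (y + z)}"
    by (auto simp: sumset_def diffset_def)
  have s1: "num_residues (2 * m) {x + x, x + y, y + y, m} =
      (if m dvd x - y then 2 else 3) + (if 2 * m dvd x + y - m then 0 else 1)"
  proof -
    have "(x + x) - (x + y) = x - y" "(x + x) - (y + y) = 2 * (x - y)" "(x + y) - (y + y) = x - y" by simp_all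
    moreover have "\<not> 2 * m dvd (x + x) - m" "\<not> 2 * m dvd (y + y) - m"
      using odd_m by (simp_all add: dvd_split)
    moreover have "2 * m dvd 2 * (x - y) \<longleftrightarrow> m dvd x - y" by (rule dvd_twice)
    ultimately show ?thesis using xy by (simp only: num_residues_simps) simp
  qed
  have s2: "num_residues (2 * m) {x + z, y + z, z - x, z - y} =
      2 + (if m dvd x \<or> 2 * m dvd x + y then 0 else 1) + (if m dvd y \<or> 2 * m dvd x + y then 0 else 1)"
  proof -
    have "(x + z) - (y + z) = x - y" "(x + z) - (z - x) = 2 * x" "(x + z) - (z - y) = x + y"
      "(y + z) - (z - x) = x + y" "(y + z) - (z - y) = 2 * y" "(z - x) - (z - y) = y - x" by simp_all
    moreover have "2 * m dvd 2 * x \<longleftrightarrow> m dvd x" "2 * m dvd 2 * y \<longleftrightarrow> m dvd y" by simp_all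
    ultimately show ?thesis using xy by (simp only: num_residues_simps) simp
  qed
  have s3: "num_residues (2 * m) {0, x - y, y - x} = (if m dvd x - y then 2 else 3)"
  proof -
    have "0 - (x - y) = y - x" "0 - (y - x) = x - y" "(x - y) - (y - x) = 2 * (x - y)" by simp_all
    moreover have "2 * m dvd 2 * (x - y) \<longleftrightarrow> m dvd x - y" by (rule dvd_twice)
    ultimately show ?thesis using xy by (simp only: num_residues_simps) simp
  qed
  have s4: "num_residues (2 * m) {x + z, y + z, m + (x + z), m + (y + z)} = (if m dvd x - y then 2 else 4)"
  proof -
    have "(x + z) - (y + z) = x - y" "(x + z) - (m + (x + z)) = - m" "(x + z) - (m + (y + z)) = (x - y) - m"
      "(y + z) - (m + (x + z)) = (y - x) - m" "(y + z) - (m + (y + z)) = - m"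
      "(m + (x + z)) - (m + (y + z)) = x - y" by simp_all
    moreover have "\<not> 2 * m dvd - m" using odd_m by (simp add: dvd_split)
    moreover have "2 * m dvd (x - y) - m \<longleftrightarrow> m dvd x - y" "2 * m dvd (y - x) - m \<longleftrightarrow> m dvd x - y"
      using xy dvd_cases[of "x - y"] dvd_cases[of "y - x"] by simp_all
    ultimately show ?thesis using xy by (simp only: num_residues_simps) simp
  qed
  have rel: "m dvd x \<longleftrightarrow> m dvd y" "m dvd x \<longleftrightarrow> m dvd x + y" "\<not> 2 * m dvd x + y" if "m dvd x - y"
    using that xy dvd_iff_of_dvd_diff[of m x y] dvd_iff_of_dvd_diff[of m "2 * x" "x + y"] dvd_double[of x]
    by (simp_all add: dvd_split)
  have rel2: "\<not> (m dvd x \<and> m dvd y)" "\<not> (m dvd x + y \<and> m dvd x)" "\<not> (m dvd x + y \<and> m dvd y)"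
    if "\<not> m dvd x - y"
    using that dvd_diff[of m x y] dvd_diff[of m "x + y" "2 * y"] dvd_diff[of m "2 * x" "x + y"]
    by auto
  have rel3: "m dvd x + y \<longleftrightarrow> 2 * m dvd x + y \<or> 2 * m dvd x + y - m"
    "\<not> (2 * m dvd x + y \<and> 2 * m dvd x + y - m)"
    unfolding dvd_shift unfolding dvd_split by auto
  \<comment> \<open>The rest is propositional in these divisibilities. Naming them keeps the simplifier from
    rewriting one into another.\<close>
  obtain p a b c e f where atoms: "p = (m dvd x - y)" "a = (m dvd x)" "b = (m dvd y)"
    "c = (m dvd x + y)" "e = (2 * m dvd x + y)" "f = (2 * m dvd x + y - m)" by blast
  have cases: "p \<and> \<not> e \<and> a = b \<and> f = a \<and> c = a \<or> \<not> p \<and> e \<and> \<not> a \<and> \<not> b \<and> \<not> f \<and> c \<or>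
      \<not> p \<and> f \<and> \<not> a \<and> \<not> b \<and> \<not> e \<and> c \<or> \<not> p \<and> \<not> (a \<and> b) \<and> \<not> e \<and> \<not> f \<and> \<not> c"
    using rel rel2 rel3 unfolding atoms[symmetric] by (cases p; cases e; cases f; simp; blast)
  show "quotient_size m {x, y} {z} < product_size m {x, y} {z} \<longleftrightarrow>
      \<not> m dvd x \<and> \<not> m dvd y \<and> \<not> m dvd x + y"
    unfolding product_size_def quotient_size_def e1 e2 e3 e4 s1 s2 s3 s4 atoms[symmetric]
    using cases by (elim disjE; cases a; cases b; simp)
  show "product_size m {x, y} {z} < quotient_size m {x, y} {z} \<longleftrightarrow> 2 * m dvd x + y"
    unfolding product_size_def quotient_size_def e1 e2 e3 e4 s1 s2 s3 s4 atoms[symmetric]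
    using cases by (elim disjE; cases a; cases b; simp)
qed

text \<open>
  For \<open>A = {a\<^sup>x, a\<^sup>y b, a\<^sup>z b}\<close> only \<open>x\<close> and the difference \<open>d = y - z\<close> matter. If \<open>m\<close> does not
  divide \<open>x\<close> and \<open>2 x\<close> is congruent to \<open>d\<close> or \<open>-d\<close> modulo \<open>m\<close>, exactly one product is lost to a
  coincidence: outside \<open>\<langle>a\<rangle>\<close> if \<open>d\<close> is even, inside \<open>\<langle>a\<rangle>\<close> if \<open>d\<close> is odd. If \<open>m\<close> divides \<open>x\<close> but not
  \<open>d\<close>, then \<open>x\<close> and \<open>-x\<close> agree modulo \<open>2 m\<close>, and two products outside \<open>\<langle>a\<rangle>\<close> are lost.
\<close>

lemma
  assumes yz: "\<not> 2 * m dvd y - z"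
  shows mstd_iff_two_reflections: "quotient_size m {x} {y, z} < product_size m {x} {y, z} \<longleftrightarrow>
      \<not> m dvd x \<and> \<not> m dvd 2 * x - (y - z) \<and> \<not> m dvd 2 * x + (y - z)"
    and mdts_iff_two_reflections: "product_size m {x} {y, z} < quotient_size m {x} {y, z} \<longleftrightarrow> m dvd x \<and> \<not> m dvd y - z"
proof -
  define d where "d = y - z"
  have d: "\<not> 2 * m dvd d" using yz by (simp add: d_def)
  have e1: "sumset {x} {x} \<union> (+) m ` diffset {y, z} {y, z} = {x + x, m, m + d, m - d}"
    and e2: "sumset {x} {y, z} \<union> diffset {y, z} {x} = {x + y, x + z, y - x, z - x}"
    and e3: "diffset {x} {x} \<union> diffset {y, z} {y, z} = {0, d, - d}"
    and e4: "sumset {x} {y, z} \<union> (+) m ` sumset {x} {y, z} =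
      {x + y, x + z, m + (x + y), m + (x + z)}"
    by (auto simp: sumset_def diffset_def d_def)
  have s1: "num_residues (2 * m) {x + x, m, m + d, m - d} =
      (if m dvd d then 2 else 3) + (if odd d \<and> (m dvd 2 * x - d \<or> m dvd 2 * x + d) then 0 else 1)"
  proof -
    have "m - (m + d) = - d" "m - (m - d) = d" "(m + d) - (m - d) = 2 * d"
      "(x + x) - (m + d) = (2 * x - d) - m" "(x + x) - (m - d) = (2 * x + d) - m" by simp_all
    moreover have "\<not> 2 * m dvd (x + x) - m" using odd_m by (simp add: dvd_split)
    moreover have "2 * m dvd (2 * x - d) - m \<longleftrightarrow> m dvd 2 * x - d \<and> odd d"
      "2 * m dvd (2 * x + d) - m \<longleftrightarrow> m dvd 2 * x + d \<and> odd d" by (simp_all add: dvd_shift)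
    moreover have "2 * m dvd 2 * d \<longleftrightarrow> m dvd d" "2 * m dvd - d \<longleftrightarrow> 2 * m dvd d" by simp_all
    ultimately show ?thesis using d by (simp only: num_residues_simps) simp
  qed
  have s2: "num_residues (2 * m) {x + y, x + z, y - x, z - x} =
      2 + (if m dvd x \<or> even d \<and> m dvd 2 * x + d then 0 else 1) +
      (if m dvd x \<or> even d \<and> m dvd 2 * x - d then 0 else 1)"
  proof -
    have "(x + y) - (x + z) = d" "(x + y) - (y - x) = 2 * x" "(x + y) - (z - x) = 2 * x + d"
      "(x + z) - (y - x) = 2 * x - d" "(x + z) - (z - x) = 2 * x" "(y - x) - (z - x) = d"
      by (simp_all add: d_def)
    moreover have "2 * m dvd 2 * x \<longleftrightarrow> m dvd x" by simp
    moreover have "2 * m dvd 2 * x + d \<longleftrightarrow> even d \<and> m dvd 2 * x + d"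
      "2 * m dvd 2 * x - d \<longleftrightarrow> even d \<and> m dvd 2 * x - d" by (auto simp: dvd_split)
    ultimately show ?thesis using d by (simp only: num_residues_simps) simp
  qed
  have s3: "num_residues (2 * m) {0, d, - d} = (if m dvd d then 2 else 3)"
  proof -
    have "0 - d = - d" "0 - (- d) = d" "d - (- d) = 2 * d" by simp_all
    moreover have "2 * m dvd 2 * d \<longleftrightarrow> m dvd d" "2 * m dvd - d \<longleftrightarrow> 2 * m dvd d" by simp_all
    ultimately show ?thesis using d by (simp only: num_residues_simps) simp
  qed
  have s4: "num_residues (2 * m) {x + y, x + z, m + (x + y), m + (x + z)} = (if m dvd d then 2 else 4)"
  proof -
    have "(x + y) - (x + z) = d" "(x + y) - (m + (x + y)) = - m" "(x + y) - (m + (x + z)) = d - m"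
      "(x + z) - (m + (x + y)) = - d - m" "(x + z) - (m + (x + z)) = - m"
      "(m + (x + y)) - (m + (x + z)) = d" by (simp_all add: d_def)
    moreover have "\<not> 2 * m dvd - m" using odd_m by (simp add: dvd_split)
    moreover have "2 * m dvd d - m \<longleftrightarrow> m dvd d" "2 * m dvd - d - m \<longleftrightarrow> m dvd d"
      using d dvd_cases[of d] dvd_cases[of "- d"] by simp_all
    ultimately show ?thesis using d by (simp only: num_residues_simps) simp
  qed
  have rel: "m dvd 2 * x - d \<longleftrightarrow> m dvd x" "m dvd 2 * x + d \<longleftrightarrow> m dvd x" "odd d" if "m dvd d"
    using that d dvd_double[of x] dvd_iff_of_dvd_diff[of m "2 * x" "2 * x - d"]
      dvd_iff_of_dvd_diff[of m "2 * x + d" "2 * x"]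
    by (simp_all add: dvd_split)
  have rel2: "\<not> (m dvd x \<and> m dvd 2 * x - d)" "\<not> (m dvd x \<and> m dvd 2 * x + d)"
    "\<not> (m dvd 2 * x - d \<and> m dvd 2 * x + d)" if "\<not> m dvd d"
    using that dvd_iff_of_dvd_diff[of m "2 * x + d" "2 * x"] dvd_iff_of_dvd_diff[of m "2 * x" "2 * x - d"]
      dvd_double[of x] dvd_double[of d] dvd_diff[of m "2 * x + d" "2 * x - d"]
      dvd_diff[of m "2 * x" "2 * x - d"] dvd_diff[of m "2 * x + d" "2 * x"]
    by auto
  \<comment> \<open>As above, the rest is propositional.\<close>
  obtain p a b c e where atoms: "p = (m dvd d)" "a = (m dvd x)" "b = (m dvd 2 * x - d)"
    "c = (m dvd 2 * x + d)" "e = even d" by blast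
  show "quotient_size m {x} {y, z} < product_size m {x} {y, z} \<longleftrightarrow>
      \<not> m dvd x \<and> \<not> m dvd 2 * x - (y - z) \<and> \<not> m dvd 2 * x + (y - z)"
    unfolding product_size_def quotient_size_def e1 e2 e3 e4 s1 s2 s3 s4 d_def[symmetric]
    using rel rel2
    unfolding atoms[symmetric] by (cases p; cases a; cases b; cases c; cases e; simp)
  show "product_size m {x} {y, z} < quotient_size m {x} {y, z} \<longleftrightarrow> m dvd x \<and> \<not> m dvd y - z"
    unfolding product_size_def quotient_size_def e1 e2 e3 e4 s1 s2 s3 s4 d_def[symmetric]
    using rel rel2
    unfolding atoms[symmetric] by (cases p; cases a; cases b; cases c; cases e; simp)
qed

text \<open>
  As \<open>(a\<^sup>y b)\<^sup>-\<^sup>1 = a\<^sup>m a\<^sup>y b\<close> with \<open>a\<^sup>m\<close> central, products and quotients of elements outside \<open>\<langle>a\<rangle>\<close>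
  differ only by the factor \<open>a\<^sup>m\<close>.
\<close>

lemma balanced_reflections: "product_size m {} Y = quotient_size m {} Y"
  by (simp add: product_size_def quotient_size_def num_residues_shift)
     (simp add: sumset_def diffset_def num_residues_shift)

end

lemma num_residues_set_le: "num_residues N (set xs) \<le> length xs"
  unfolding num_residues_def by (rule order_trans[OF card_image_le card_length]) simp

context odd_modulus begin

text \<open>
  For \<open>X = {x, y, z}\<close> the sum of \<open>X\<close> minus \<open>3 y\<close> is \<open>x + z - 2 y\<close>, so the last assumption says that
  \<open>y\<close> is the middle term of the progression \<open>x, y, z\<close>, which is symmetric about \<open>y\<close>.
\<close>

lemma balanced_of_midpoint:
  assumes "card X = 3" "y \<in> X" "2 * m dvd \<Sum>X - 3 * y"
  shows "product_size m X {} = quotient_size m X {}"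
proof -
  have "finite X" using assms(1) by (simp add: card_ge_0_finite)
  then have "card (X - {y}) = 2" using assms by simp
  then obtain x z where xz: "X - {y} = {x, z}" "x \<noteq> z" by (auto simp: card_2_iff)
  then have X: "X = {x, y, z}" and "x \<noteq> y" "z \<noteq> y" using assms(2) by auto
  then have "2 * m dvd x + z - 2 * y" using assms(3) xz by (simp add: algebra_simps)
  then have "\<exists>x'\<in>X. 2 * m dvd u + x' - 2 * y" if "u \<in> X" for u
    using that X by (auto simp: add.commute)
  then have "num_residues (2 * m) (sumset X X) = num_residues (2 * m) (diffset X X)"
    by (rule num_residues_sumset_symmetric)
  then show ?thesis
    by (simp add: product_size_def quotient_size_def) (simp add: sumset_def diffset_def)
qed

text \<open>
  Without a midpoint the seven differences coincide only as \<open>e = -e\<close>, which means that \<open>m\<close> divides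
  the difference \<open>e\<close>. This happens for at most one pair of elements, and then the doubles of these
  two elements agree, so that one of the six sums is lost as well.
\<close>

lemma mdts_of_no_midpoint:
  assumes card: "card X = 3"
    and inc: "\<And>u v. u \<in> X \<Longrightarrow> v \<in> X \<Longrightarrow> u \<noteq> v \<Longrightarrow> \<not> 2 * m dvd u - v"
    and mid: "\<And>y. y \<in> X \<Longrightarrow> \<not> 2 * m dvd \<Sum>X - 3 * y"
  shows "product_size m X {} < quotient_size m X {}"
proof -
  obtain x y z where X: "X = {x, y, z}" and ne: "x \<noteq> y" "y \<noteq> z" "x \<noteq> z"
    using card by (auto simp: card_3_iff)
  define a b where "a = x - y" and "b = y - z"
  have neg: "2 * m dvd - e \<longleftrightarrow> 2 * m dvd e" for e by simp
  have nd: "\<not> 2 * m dvd a" "\<not> 2 * m dvd b" "\<not> 2 * m dvd a + b"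
    using inc[of x y] inc[of y z] inc[of x z] ne by (simp_all add: X a_def b_def)
  have nm: "\<not> 2 * m dvd b - a" "\<not> 2 * m dvd 2 * a + b" "\<not> 2 * m dvd a + 2 * b"
    using mid[of x] mid[of y] mid[of z] ne neg[of "2 * a + b"] neg[of "b - a"]
    by (simp_all add: X a_def b_def algebra_simps)
  have diff: "diffset X X = {0, a, - a, b, - b, a + b, - (a + b)}"
    by (auto simp: diffset_def X a_def b_def)
  have D: "num_residues (2 * m) (diffset X X) =
      1 + (if m dvd a then 1 else 2) + (if m dvd b then 1 else 2) + (if m dvd a + b then 1 else 2)"
  proof -
    have eqs: "0 - a = - a" "0 - - a = a" "0 - b = - b" "0 - - b = b" "0 - (a + b) = - (a + b)"
      "0 - - (a + b) = a + b" "a - - a = 2 * a" "a - b = - (b - a)" "a - - b = a + b"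
      "a - (a + b) = - b" "a - - (a + b) = 2 * a + b" "- a - b = - (a + b)" "- a - - b = b - a"
      "- a - (a + b) = - (2 * a + b)" "- a - - (a + b) = b" "b - - b = 2 * b" "b - (a + b) = - a"
      "b - - (a + b) = a + 2 * b" "- b - (a + b) = - (a + 2 * b)" "- b - - (a + b) = a"
      "(a + b) - - (a + b) = 2 * (a + b)" by simp_all
    show ?thesis unfolding diff
      by (simp only: num_residues_simps eqs neg nd nm dvd_twice) simp
  qed
  have sum: "sumset X X = {x + x, y + y, z + z, x + y, y + z, x + z}"
    by (auto simp: sumset_def X)
  have dbl: "(x + x) - (y + y) = 2 * a" "(y + y) - (z + z) = 2 * b" "(x + x) - (z + z) = 2 * (a + b)"
    by (simp_all add: a_def b_def)
  have le5: "num_residues (2 * m) {p, q, r, s, t} \<le> 5" for p q r s t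
    using num_residues_set_le[of "2 * m" "[p, q, r, s, t]"] by (simp del: num_residues_insert)
  have S6: "num_residues (2 * m) (sumset X X) \<le> 6"
    using num_residues_set_le[of "2 * m" "[x + x, y + y, z + z, x + y, y + z, x + z]"] unfolding sum
    by (simp del: num_residues_insert)
  have S5: "num_residues (2 * m) (sumset X X) \<le> 5" if "m dvd a \<or> m dvd b \<or> m dvd a + b"
    using that
  proof (elim disjE)
    assume "m dvd a"
    then have "num_residues (2 * m) (sumset X X) = num_residues (2 * m) {y + y, z + z, x + y, y + z, x + z}"
      unfolding sum by (subst num_residues_insert) (auto simp only: dbl dvd_twice finite.emptyI finite.insertI bex_simps simp_thms if_True)
    then show ?thesis using le5 by simp
  next
    assume "m dvd b"
    then have "num_residues (2 * m) {y + y, z + z, x + x, x + y, y + z, x + z} =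
        num_residues (2 * m) {z + z, x + x, x + y, y + z, x + z}"
      by (subst num_residues_insert) (auto simp only: dbl dvd_twice finite.emptyI finite.insertI bex_simps simp_thms if_True)
    moreover have "sumset X X = {y + y, z + z, x + x, x + y, y + z, x + z}" using sum by auto
    ultimately show ?thesis using le5 by simp
  next
    assume "m dvd a + b"
    then have "num_residues (2 * m) {x + x, z + z, y + y, x + y, y + z, x + z} =
        num_residues (2 * m) {z + z, y + y, x + y, y + z, x + z}"
      by (subst num_residues_insert) (auto simp only: dbl dvd_twice finite.emptyI finite.insertI bex_simps simp_thms if_True)
    moreover have "sumset X X = {x + x, z + z, y + y, x + y, y + z, x + z}" using sum by auto
    ultimately show ?thesis using le5 by simp
  qed
  have one: "\<not> (m dvd a \<and> m dvd b)" "\<not> (m dvd a \<and> m dvd a + b)" "\<not> (m dvd b \<and> m dvd a + b)"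
  proof -
    show ab: "\<not> (m dvd a \<and> m dvd b)" using nd by (auto simp: dvd_split)
    show "\<not> (m dvd a \<and> m dvd a + b)" "\<not> (m dvd b \<and> m dvd a + b)"
      using ab dvd_add_right_iff[of m a b] dvd_add_left_iff[of m b a] by auto
  qed
  have "num_residues (2 * m) (sumset X X) < num_residues (2 * m) (diffset X X)"
    unfolding D using S5 S6 one by (auto split: if_splits)
  then show ?thesis
    by (simp add: product_size_def quotient_size_def) (simp add: sumset_def diffset_def)
qed

end

section \<open>Counting\<close>

lemma six_choose_three: "6 * int (k choose 3) = int k * (int k - 1) * (int k - 2)"
proof -
  have two: "2 * int (k choose 2) = int k * (int k - 1)" for k
    by (induction k) (simp_all add: numeral_2_eq_2 algebra_simps)
  show ?thesis
  proof (induction k)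
    case (Suc k)
    have "Suc k choose 3 = (k choose 2) + (k choose 3)" by (simp add: numeral_3_eq_3 numeral_2_eq_2)
    then have "6 * int (Suc k choose 3) = 3 * (2 * int (k choose 2)) + 6 * int (k choose 3)" by simp
    also have "\<dots> = int (Suc k) * (int (Suc k) - 1) * (int (Suc k) - 2)"
      unfolding two Suc.IH by (simp add: algebra_simps)
    finally show ?case .
  qed simp
qed

lemma sum_if_zero:
  fixes c :: "'b::semiring_1"
  assumes "finite A"
  shows "(\<Sum>x\<in>A. if P x then 0 else c) = of_nat (card {x \<in> A. \<not> P x}) * c"
proof -
  have "(\<Sum>x\<in>A. if P x then 0 else c) = (\<Sum>x\<in>A. if \<not> P x then c else 0)"
    by (rule sum.cong) auto
  also have "\<dots> = (\<Sum>x\<in>{x \<in> A. \<not> P x}. c)" using assms by (rule sum.inter_filter[symmetric])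
  finally show ?thesis by simp
qed

text \<open>
  Double counting of the incidences \<open>x \<in> X\<close>. It reduces counting unordered pairs to counting,
  for every \<open>x\<close>, the admissible partners, which is a matter of residues to be avoided.
\<close>

lemma card_pairs:
  assumes "finite A"
  shows "2 * card {X. X \<subseteq> A \<and> card X = 2 \<and> P X} = (\<Sum>x\<in>A. card {y \<in> A. y \<noteq> x \<and> P {x, y}})"
proof -
  let ?F = "{X. X \<subseteq> A \<and> card X = 2 \<and> P X}"
  have fin: "finite ?F" using assms by simp
  have "card {y \<in> A. y \<noteq> x \<and> P {x, y}} = card {X \<in> ?F. x \<in> X}" if "x \<in> A" for x
  proof (rule bij_betw_same_card[of "\<lambda>y. {x, y}"], unfold bij_betw_def, intro conjI)
    show "inj_on (\<lambda>y. {x, y}) {y \<in> A. y \<noteq> x \<and> P {x, y}}"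
      by (auto simp: inj_on_def doubleton_eq_iff)
    show "(\<lambda>y. {x, y}) ` {y \<in> A. y \<noteq> x \<and> P {x, y}} = {X \<in> ?F. x \<in> X}"
      using that by (auto simp: card_2_iff image_iff insert_commute)
  qed
  then have "(\<Sum>x\<in>A. card {y \<in> A. y \<noteq> x \<and> P {x, y}}) = (\<Sum>x\<in>A. card {X \<in> ?F. x \<in> X})" by simp
  also have "\<dots> = 2 * card ?F"
  proof (rule sum_multicount[OF assms fin], clarify)
    fix X assume "X \<subseteq> A" "card X = 2"
    moreover from this have "{x \<in> A. x \<in> X} = X" by blast
    ultimately show "card {x \<in> A. x \<in> X} = 2" by simp
  qed
  finally show ?thesis by simp
qed

lemma card_subset_pairs:
  fixes Z :: "'a set"
  assumes "finite Z"
  shows "card {(X, Y). X \<subseteq> Z \<and> Y \<subseteq> Z \<and> card X + card Y = 3 \<and> R X Y} =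
    card {X. X \<subseteq> Z \<and> card X = 3 \<and> R X {}} +
    (\<Sum>z\<in>Z. card {X. X \<subseteq> Z \<and> card X = 2 \<and> R X {z}}) +
    (\<Sum>x\<in>Z. card {Y. Y \<subseteq> Z \<and> card Y = 2 \<and> R {x} Y}) +
    card {Y. Y \<subseteq> Z \<and> card Y = 3 \<and> R {} Y}" (is "card ?S = _")
proof -
  have fin: "finite X" if "X \<subseteq> Z" for X using that assms finite_subset by blast
  let ?A = "(\<lambda>X. (X, {} :: 'a set)) ` {X. X \<subseteq> Z \<and> card X = 3 \<and> R X {}}"
  let ?B = "(\<lambda>(z, X). (X, {z})) ` (SIGMA z:Z. {X. X \<subseteq> Z \<and> card X = 2 \<and> R X {z}})"
  let ?C = "(\<lambda>(x, Y). ({x}, Y)) ` (SIGMA x:Z. {Y. Y \<subseteq> Z \<and> card Y = 2 \<and> R {x} Y})"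
  let ?D = "(\<lambda>Y. ({} :: 'a set, Y)) ` {Y. Y \<subseteq> Z \<and> card Y = 3 \<and> R {} Y}"
  have "?S = ?A \<union> ?B \<union> ?C \<union> ?D"
  proof (intro equalityI subsetI)
    fix p assume "p \<in> ?S"
    then obtain X Y where p: "p = (X, Y)" and XY: "X \<subseteq> Z" "Y \<subseteq> Z" "card X + card Y = 3" "R X Y" by auto
    from XY(3) consider "card X = 3" "card Y = 0" | "card X = 2" "card Y = 1"
      | "card X = 1" "card Y = 2" | "card X = 0" "card Y = 3" by linarith
    then show "p \<in> ?A \<union> ?B \<union> ?C \<union> ?D"
    proof cases
      case 1
      then have "Y = {}" using fin XY by simp
      then show ?thesis using p XY 1 by auto
    next
      case 2
      then obtain z where "Y = {z}" by (auto simp: card_1_singleton_iff)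
      then show ?thesis using p XY 2 by (auto simp: image_iff)
    next
      case 3
      then obtain x where "X = {x}" by (auto simp: card_1_singleton_iff)
      then show ?thesis using p XY 3 by (auto simp: image_iff)
    next
      case 4
      then have "X = {}" using fin XY by simp
      then show ?thesis using p XY 4 by auto
    qed
  qed auto
  moreover have "card (?A \<union> ?B \<union> ?C \<union> ?D) = card ?A + card ?B + card ?C + card ?D"
  proof -
    have "finite ?A" "finite ?B" "finite ?C" "finite ?D" using assms by simp_all
    moreover have "?A \<inter> ?B = {}" "(?A \<union> ?B) \<inter> ?C = {}" "(?A \<union> ?B \<union> ?C) \<inter> ?D = {}" by auto
    ultimately show ?thesis by (simp only: card_Un_disjoint finite_Un simp_thms)
  qed
  moreover have "card ?A = card {X. X \<subseteq> Z \<and> card X = 3 \<and> R X {}}"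
    "card ?D = card {Y. Y \<subseteq> Z \<and> card Y = 3 \<and> R {} Y}"
    by (auto intro!: card_image inj_onI)
  moreover have "card ?B = (\<Sum>z\<in>Z. card {X. X \<subseteq> Z \<and> card X = 2 \<and> R X {z}})"
    using assms by (subst card_image) (auto intro!: inj_onI)
  moreover have "card ?C = (\<Sum>x\<in>Z. card {Y. Y \<subseteq> Z \<and> card Y = 2 \<and> R {x} Y})"
    using assms by (subst card_image) (auto intro!: inj_onI)
  ultimately show ?thesis by simp
qed

context odd_modulus begin

abbreviation Z :: "int set" where "Z \<equiv> {0..<2 * m}"

lemma Z_congruent_iff: "u \<in> Z \<Longrightarrow> v \<in> Z \<Longrightarrow> 2 * m dvd u - v \<longleftrightarrow> u = v"
  by (simp flip: mod_eq_dvd_iff)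

lemma card_avoid:
  assumes "finite S"
  shows "int (card {z \<in> Z. \<forall>s\<in>S. \<not> 2 * m dvd z - s}) = 2 * m - int (num_residues (2 * m) S)"
proof -
  have "(\<lambda>i. i mod (2 * m)) ` S \<subseteq> Z" using m3 by auto
  then have "num_residues (2 * m) S \<le> card Z" unfolding num_residues_def by (rule card_mono[rotated]) simp
  then show ?thesis using card_avoid_residues[of "2 * m" S] assms m3 by simp
qed

lemma card_not_dvd: "int (card {x \<in> Z. \<not> m dvd x - y}) = 2 * m - 2"
proof -
  have "num_residues (2 * m) {y, y + m} = 2" using odd_m by (simp add: dvd_split)
  moreover have "{x \<in> Z. \<not> m dvd x - y} = {x \<in> Z. \<forall>s\<in>{y, y + m}. \<not> 2 * m dvd x - s}"
    by (auto simp: dvd_cases[of "_ - y"] algebra_simps)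
  ultimately show ?thesis using card_avoid[of "{y, y + m}"] by simp
qed

lemma card_not_dvd0: "int (card {x \<in> Z. \<not> m dvd x}) = 2 * m - 2"
  using card_not_dvd[of 0] by simp

text \<open>
  For every \<open>x\<close> the partner \<open>2 y - x\<close> is determined, and it differs from \<open>x\<close> unless \<open>m\<close> divides
  \<open>x - y\<close>, which excludes two values of \<open>x\<close>.
\<close>

lemma card_pairs_with_sum: "int (card {X. X \<subseteq> Z \<and> card X = 2 \<and> 2 * m dvd \<Sum>X - 2 * y}) = m - 1"
proof -
  have "card {z \<in> Z. z \<noteq> x \<and> 2 * m dvd \<Sum>{x, z} - 2 * y} = (if m dvd x - y then 0 else 1)"
    if x: "x \<in> Z" for x
  proof -
    let ?r = "(2 * y - x) mod (2 * m)"
    have r: "?r \<in> Z" using m3 by simp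
    have sol: "2 * m dvd x + z - 2 * y \<longleftrightarrow> z = ?r" if "z \<in> Z" for z
    proof -
      have "z = ?r \<longleftrightarrow> z mod (2 * m) = ?r" using that by simp
      also have "\<dots> \<longleftrightarrow> 2 * m dvd x + z - 2 * y" unfolding mod_eq_dvd_iff by (simp add: algebra_simps)
      finally show ?thesis by simp
    qed
    have "x = ?r \<longleftrightarrow> m dvd x - y"
      using sol[OF x] dvd_twice[of "x - y"] by (simp add: algebra_simps)
    then have "{z \<in> Z. z \<noteq> x \<and> 2 * m dvd \<Sum>{x, z} - 2 * y} = (if m dvd x - y then {} else {?r})"
      using sol r by auto
    then show ?thesis by simp
  qed
  then have "(\<Sum>x\<in>Z. card {z \<in> Z. z \<noteq> x \<and> 2 * m dvd \<Sum>{x, z} - 2 * y}) =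
      (\<Sum>x\<in>Z. if m dvd x - y then 0 else 1)" by (rule sum.cong[OF HOL.refl])
  then have "2 * card {X. X \<subseteq> Z \<and> card X = 2 \<and> 2 * m dvd \<Sum>X - 2 * y} = (\<Sum>x\<in>Z. if m dvd x - y then 0 else 1)"
    using card_pairs[of Z "\<lambda>X. 2 * m dvd \<Sum>X - 2 * y"] by (simp only: finite_atLeastLessThan_int)
  also have "\<dots> = card {x \<in> Z. \<not> m dvd x - y}" by (subst sum_if_zero) simp_all
  finally show ?thesis using card_not_dvd[of y] by simp
qed

text \<open>
  There are \<open>2 m - 2\<close> choices for \<open>x\<close>, and the second exponent must avoid the five residues
  \<open>x\<close>, \<open>0\<close>, \<open>m\<close>, \<open>-x\<close> and \<open>m - x\<close>.
\<close>

lemma count_mstd_two_rotations: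
  "2 * int (card {X. X \<subseteq> Z \<and> card X = 2 \<and> quotient_size m X {z} < product_size m X {z}}) =
    (2 * m - 2) * (2 * m - 5)"
proof -
  have "int (card {y \<in> Z. y \<noteq> x \<and> quotient_size m {x, y} {z} < product_size m {x, y} {z}}) =
      (if m dvd x then 0 else 2 * m - 5)" if x: "x \<in> Z" for x
  proof -
    let ?S = "{x, 0, m, - x, m - x}"
    have "{y \<in> Z. y \<noteq> x \<and> quotient_size m {x, y} {z} < product_size m {x, y} {z}} =
        (if m dvd x then {} else {y \<in> Z. \<forall>s\<in>?S. \<not> 2 * m dvd y - s})" (is "?L = ?R")
    proof -
      have "y \<in> ?L \<longleftrightarrow> y \<in> ?R" for y
      proof (cases "y \<in> Z \<and> y \<noteq> x")
        case True
        then have "\<not> 2 * m dvd x - y" "\<not> 2 * m dvd y - x" using x Z_congruent_iff by auto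
        moreover have "m dvd y \<longleftrightarrow> 2 * m dvd y - 0 \<or> 2 * m dvd y - m"
          "m dvd x + y \<longleftrightarrow> 2 * m dvd y - - x \<or> 2 * m dvd y - (m - x)"
          using dvd_cases[of y] dvd_cases[of "x + y"] by (simp_all add: algebra_simps)
        ultimately show ?thesis using True by (simp add: mstd_iff_two_rotations)
      qed (use x in auto)
      then show ?thesis by blast
    qed
    moreover have "num_residues (2 * m) ?S = 5" if "\<not> m dvd x"
    proof -
      have "x - 0 = x" "x - - x = 2 * x" "x - (m - x) = 2 * x - m" "0 - m = - m" "0 - - x = x" "0 - (m - x) = x - m"
        "m - - x = - (- x - m)" "m - (m - x) = x" "- x - (m - x) = - m" by simp_all
      moreover have "\<not> 2 * m dvd x" "\<not> 2 * m dvd - m" "\<not> 2 * m dvd x - m" "\<not> 2 * m dvd - (- x - m)"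
          "\<not> 2 * m dvd 2 * x - m" "\<not> 2 * m dvd 2 * x"
        using that odd_m dvd_double[of x] unfolding dvd_minus_iff dvd_shift by (auto simp: dvd_split)
      ultimately show ?thesis by (simp only: num_residues_simps)
    qed
    ultimately show ?thesis using card_avoid[of ?S] by simp
  qed
  then have "2 * int (card {X. X \<subseteq> Z \<and> card X = 2 \<and> quotient_size m X {z} < product_size m X {z}}) =
      (\<Sum>x\<in>Z. if m dvd x then 0 else 2 * m - 5)"
    using card_pairs[of Z "\<lambda>X. quotient_size m X {z} < product_size m X {z}", THEN arg_cong[of _ _ int]]
    by simp
  also have "\<dots> = int (card {x \<in> Z. \<not> m dvd x}) * (2 * m - 5)" by (subst sum_if_zero) simp_all
  finally show ?thesis by (simp only: card_not_dvd0)
qed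

lemma count_mdts_two_rotations:
  "int (card {X. X \<subseteq> Z \<and> card X = 2 \<and> product_size m X {z} < quotient_size m X {z}}) = m - 1"
proof -
  have "{X. X \<subseteq> Z \<and> card X = 2 \<and> product_size m X {z} < quotient_size m X {z}} =
      {X. X \<subseteq> Z \<and> card X = 2 \<and> 2 * m dvd \<Sum>X - 2 * 0}"
  proof (intro Collect_cong conj_cong HOL.refl)
    fix X assume "X \<subseteq> Z" "card X = 2"
    then obtain x y where X: "X = {x, y}" "x \<noteq> y" and "x \<in> Z" "y \<in> Z" by (auto simp: card_2_iff)
    then have "\<not> 2 * m dvd x - y" using Z_congruent_iff by blast
    then show "product_size m X {z} < quotient_size m X {z} \<longleftrightarrow> 2 * m dvd \<Sum>X - 2 * 0"
      using X by (simp add: mdts_iff_two_rotations)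
  qed
  then show ?thesis using card_pairs_with_sum[of 0] by simp
qed

text \<open>
  For given \<open>y\<close> the other exponent must avoid the five residues \<open>y\<close>, \<open>y \<plusminus> 2 x\<close> and \<open>y \<plusminus> 2 x + m\<close>.
\<close>

lemma count_mstd_two_reflections:
  "int (card {Y. Y \<subseteq> Z \<and> card Y = 2 \<and> quotient_size m {x} Y < product_size m {x} Y}) =
    (if m dvd x then 0 else m * (2 * m - 5))"
proof -
  have "int (card {z \<in> Z. z \<noteq> y \<and> quotient_size m {x} {y, z} < product_size m {x} {y, z}}) =
      (if m dvd x then 0 else 2 * m - 5)" if y: "y \<in> Z" for y
  proof -
    let ?S = "{y, y - 2 * x, y - 2 * x + m, y + 2 * x, y + 2 * x + m}"
    have "{z \<in> Z. z \<noteq> y \<and> quotient_size m {x} {y, z} < product_size m {x} {y, z}} =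
        (if m dvd x then {} else {z \<in> Z. \<forall>s\<in>?S. \<not> 2 * m dvd z - s})" (is "?L = ?R")
    proof -
      have "z \<in> ?L \<longleftrightarrow> z \<in> ?R" for z
      proof (cases "z \<in> Z \<and> z \<noteq> y")
        case True
        then have "\<not> 2 * m dvd y - z" "\<not> 2 * m dvd z - y" using y Z_congruent_iff by auto
        moreover have "m dvd 2 * x - (y - z) \<longleftrightarrow> 2 * m dvd z - (y - 2 * x) \<or> 2 * m dvd z - (y - 2 * x + m)"
          using dvd_cases[of "2 * x - (y - z)"] by (simp add: algebra_simps)
        moreover have "m dvd 2 * x + (y - z) \<longleftrightarrow> 2 * m dvd z - (y + 2 * x) \<or> 2 * m dvd z - (y + 2 * x + m)"
          using dvd_cases[of "z - (y + 2 * x)"] dvd_minus_iff[of m "2 * x + (y - z)"] by (simp add: algebra_simps)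
        ultimately show ?thesis using True by (simp add: mstd_iff_two_reflections)
      qed (use y in auto)
      then show ?thesis by blast
    qed
    moreover have "num_residues (2 * m) ?S = 5" if "\<not> m dvd x"
    proof -
      have "y - (y - 2 * x) = 2 * x" "y - (y - 2 * x + m) = 2 * x - m" "y - (y + 2 * x) = - (2 * x)"
        "y - (y + 2 * x + m) = - (2 * x) - m" "(y - 2 * x) - (y - 2 * x + m) = - m"
        "(y - 2 * x) - (y + 2 * x) = - (2 * (2 * x))" "(y - 2 * x) - (y + 2 * x + m) = - (2 * (2 * x)) - m"
        "(y - 2 * x + m) - (y + 2 * x) = - (2 * (2 * x) - m)"
        "(y - 2 * x + m) - (y + 2 * x + m) = - (2 * (2 * x))" "(y + 2 * x) - (y + 2 * x + m) = - m" by simp_all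
      moreover have "\<not> 2 * m dvd 2 * x" "\<not> 2 * m dvd - m" "\<not> 2 * m dvd 2 * x - m" "\<not> 2 * m dvd - (2 * x)"
          "\<not> 2 * m dvd - (2 * x) - m" "\<not> 2 * m dvd - (2 * (2 * x))" "\<not> 2 * m dvd - (2 * (2 * x)) - m"
          "\<not> 2 * m dvd - (2 * (2 * x) - m)"
        using that odd_m dvd_double[of x] dvd_double[of "2 * x"]
        unfolding dvd_minus_iff dvd_shift unfolding dvd_minus_iff dvd_split by simp_all
      ultimately show ?thesis by (simp only: num_residues_simps)
    qed
    ultimately show ?thesis using card_avoid[of ?S] by simp
  qed
  then have "2 * int (card {Y. Y \<subseteq> Z \<and> card Y = 2 \<and> quotient_size m {x} Y < product_size m {x} Y}) =
      (\<Sum>y\<in>Z. if m dvd x then 0 else 2 * m - 5)"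
    using card_pairs[of Z "\<lambda>Y. quotient_size m {x} Y < product_size m {x} Y", THEN arg_cong[of _ _ int]]
    by simp
  then show ?thesis using m3 by simp
qed

lemma count_mdts_two_reflections:
  "int (card {Y. Y \<subseteq> Z \<and> card Y = 2 \<and> product_size m {x} Y < quotient_size m {x} Y}) =
    (if m dvd x then m * (2 * m - 2) else 0)"
proof -
  have "int (card {z \<in> Z. z \<noteq> y \<and> product_size m {x} {y, z} < quotient_size m {x} {y, z}}) =
      (if m dvd x then 2 * m - 2 else 0)" if y: "y \<in> Z" for y
  proof -
    have "{z \<in> Z. z \<noteq> y \<and> product_size m {x} {y, z} < quotient_size m {x} {y, z}} =
        (if m dvd x then {z \<in> Z. \<not> m dvd z - y} else {})"
    proof -
      have "z \<noteq> y \<and> product_size m {x} {y, z} < quotient_size m {x} {y, z} \<longleftrightarrow>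
          m dvd x \<and> \<not> m dvd z - y" if "z \<in> Z" for z
        using y that Z_congruent_iff[of y z] mdts_iff_two_reflections[of y z x] dvd_diff_commute[of m z y]
        by (cases "z = y") auto
      then show ?thesis by auto
    qed
    then show ?thesis using card_not_dvd[of y] by simp
  qed
  then have "2 * int (card {Y. Y \<subseteq> Z \<and> card Y = 2 \<and> product_size m {x} Y < quotient_size m {x} Y}) =
      (\<Sum>y\<in>Z. if m dvd x then 2 * m - 2 else 0)"
    using card_pairs[of Z "\<lambda>Y. product_size m {x} Y < quotient_size m {x} Y", THEN arg_cong[of _ _ int]]
    by simp
  then show ?thesis using m3 by simp
qed

end

text \<open>
  The middle terms of the arithmetic progressions modulo \<open>2 m\<close> that are arrangements of the
  three-element set \<open>X\<close>; for \<open>X = {x, y, z}\<close> the divisibility reads \<open>x + z \<equiv> 2 y\<close>.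
\<close>

definition midpoints :: "int \<Rightarrow> int set \<Rightarrow> int set" where
  "midpoints m X = {y \<in> X. 2 * m dvd \<Sum>X - 3 * y}"

context odd_modulus begin

text \<open>
  For \<open>X = {x, y, z}\<close> the three numbers \<open>\<Sum>X - 3 x\<close>, \<open>\<Sum>X - 3 y\<close>, \<open>\<Sum>X - 3 z\<close> add up to zero. Hence two
  midpoints force the third, and the number of midpoints is 0, 1 or 3.
\<close>

lemma card_midpoints:
  assumes "card X = 3"
  shows "card (midpoints m X) = (if midpoints m X = {} then 0 else 1) + (if midpoints m X \<noteq> X then 0 else 2)"
proof (cases "midpoints m X = X")
  case True
  then show ?thesis using assms by auto
next
  case False
  have fin: "finite X" using assms by (simp add: card_ge_0_finite)
  have "y = z" if yz: "y \<in> midpoints m X" "z \<in> midpoints m X" for y z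
  proof (rule ccontr)
    assume "y \<noteq> z"
    have "y \<in> X" "z \<in> X" using yz by (auto simp: midpoints_def)
    with \<open>y \<noteq> z\<close> fin assms have "card (X - {y, z}) = 1" by (simp add: card_Diff_subset)
    then obtain x where x: "X - {y, z} = {x}" by (auto simp: card_1_singleton_iff)
    then have X: "X = {x, y, z}" and "x \<noteq> y" "x \<noteq> z" using \<open>y \<in> X\<close> \<open>z \<in> X\<close> by auto
    then have S: "\<Sum>X = x + y + z" using \<open>y \<noteq> z\<close> by simp
    \<comment> \<open>This number is the excess of the sum over 3 times the remaining element.\<close>
    have "2 * m dvd - (\<Sum>X - 3 * y) - (\<Sum>X - 3 * z)"
      using yz by (auto simp only: midpoints_def mem_Collect_eq dvd_minus_iff intro!: dvd_diff)
    then have "2 * m dvd \<Sum>X - 3 * x" by (simp add: S algebra_simps)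
    then have "midpoints m X = X" using yz X by (auto simp: midpoints_def)
    then show False using False by simp
  qed
  moreover have "finite (midpoints m X)" using fin by (simp add: midpoints_def)
  ultimately have "card (midpoints m X) \<le> 1" by (simp add: card_le_Suc0_iff_eq)
  then show ?thesis using False \<open>finite (midpoints m X)\<close> by (auto simp: le_Suc_eq)
qed

text \<open>
  Removing a midpoint \<open>y\<close> leaves a pair with sum \<open>2 y\<close> modulo \<open>2 m\<close>, so each of the \<open>2 m\<close> values of \<open>y\<close> is the
  midpoint of \<open>m - 1\<close> sets.
\<close>

lemma sum_card_midpoints:
  "int (\<Sum>X | X \<subseteq> Z \<and> card X = 3. card (midpoints m X)) = 2 * m * (m - 1)"
proof -
  let ?F = "{X. X \<subseteq> Z \<and> card X = 3}"
  have fin: "finite ?F" by simp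
  have point: "int (card {X \<in> ?F. y \<in> midpoints m X}) = m - 1" if y: "y \<in> Z" for y
  proof -
    let ?W = "{W. W \<subseteq> Z \<and> card W = 2 \<and> 2 * m dvd \<Sum>W - 2 * y}"
    have notin: "y \<notin> W" if "W \<in> ?W" for W
    proof
      assume "y \<in> W"
      then obtain w where "W = {y, w}" "w \<noteq> y" using \<open>W \<in> ?W\<close> by (auto simp: card_2_iff)
      then have "2 * m dvd w - y" "w \<in> Z" using \<open>W \<in> ?W\<close> by (auto simp: algebra_simps)
      then show False using Z_congruent_iff[of w y] y \<open>w \<noteq> y\<close> by simp
    qed
    have fW: "finite W" if "W \<in> ?W" for W using that by (simp add: card_ge_0_finite)
    have "bij_betw (insert y) ?W {X \<in> ?F. y \<in> midpoints m X}"
      unfolding bij_betw_def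
    proof (intro conjI equalityI subsetI)
      show "inj_on (insert y) ?W" using notin by (auto simp: inj_on_def insert_ident)
    next
      fix X assume "X \<in> insert y ` ?W"
      then obtain W where W: "W \<in> ?W" "X = insert y W" by blast
      then show "X \<in> {X \<in> ?F. y \<in> midpoints m X}"
        using notin[OF W(1)] fW[OF W(1)] y by (simp add: midpoints_def algebra_simps)
    next
      fix X assume X: "X \<in> {X \<in> ?F. y \<in> midpoints m X}"
      then have "y \<in> X" "finite X" by (auto simp: midpoints_def card_ge_0_finite)
      then have "\<Sum>X = y + \<Sum>(X - {y})" by (simp add: sum.remove)
      then have "X - {y} \<in> ?W" using X \<open>y \<in> X\<close> by (auto simp: midpoints_def algebra_simps)
      moreover have "X = insert y (X - {y})" using \<open>y \<in> X\<close> by auto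
      ultimately show "X \<in> insert y ` ?W" by blast
    qed
    then show ?thesis using card_pairs_with_sum[of y] bij_betw_same_card by fastforce
  qed
  have "(\<Sum>y\<in>Z. card {X \<in> ?F. y \<in> midpoints m X}) = (\<Sum>X\<in>?F. card (midpoints m X))"
  proof (rule sum_multicount_gen[OF _ fin], simp, clarify)
    fix X assume "X \<subseteq> Z"
    then have "{y \<in> Z. y \<in> midpoints m X} = midpoints m X" by (auto simp: midpoints_def)
    then show "card {y \<in> Z. y \<in> midpoints m X} = card (midpoints m X)" by simp
  qed
  then have "int (\<Sum>X\<in>?F. card (midpoints m X)) = (\<Sum>y\<in>Z. int (card {X \<in> ?F. y \<in> midpoints m X}))"
    by (simp flip: of_nat_sum)
  also have "\<dots> = (\<Sum>y\<in>Z. m - 1)" by (rule sum.cong[OF HOL.refl point])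
  finally show ?thesis using m3 by simp
qed

text \<open>
  All three elements are midpoints exactly for the cosets of the subgroup of order 3.
\<close>

lemma card_all_midpoints_of_3_dvd:
  assumes "m = 3 * t"
  shows "int (card {X. X \<subseteq> Z \<and> card X = 3 \<and> midpoints m X = X}) = 2 * t"
proof -
  let ?f = "\<lambda>r. {r, r + 2 * t, r + 4 * t}"
  have t: "t > 0" using assms m3 by simp
  have "{X. X \<subseteq> Z \<and> card X = 3 \<and> midpoints m X = X} = ?f ` {0..<2 * t}" (is "?T = _")
  proof (intro equalityI subsetI)
    fix X assume X: "X \<in> ?T"
    then obtain x where "x \<in> X" by fastforce
    define r where "r = x mod (2 * t)"
    have r: "r \<in> {0..<2 * t}" using t by (simp add: r_def)
    have "u \<in> ?f r" if "u \<in> X" for u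
    proof -
      have "x \<in> midpoints m X" "u \<in> midpoints m X" using X \<open>x \<in> X\<close> that by auto
      then have "2 * m dvd (\<Sum>X - 3 * x) - (\<Sum>X - 3 * u)"
        by (auto simp only: midpoints_def mem_Collect_eq intro!: dvd_diff)
      then have "3 * (2 * t) dvd 3 * (u - x)" by (simp add: assms algebra_simps)
      then have "2 * t dvd u - x" by (simp only: dvd_mult_cancel_left) simp
      then have ur: "u mod (2 * t) = r" by (simp add: r_def mod_eq_dvd_iff)
      have u: "0 \<le> u" "u < 2 * t * 3" using that X by (auto simp: assms)
      then have "0 \<le> u div (2 * t)" using t by (simp add: pos_imp_zdiv_nonneg_iff)
      moreover have "2 * t * (u div (2 * t)) < 2 * t * 3"
        using u t mult_div_mod_eq[of "2 * t" u] pos_mod_sign[of "2 * t" u] by linarith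
      then have "u div (2 * t) < 3" using t by (simp only: mult_less_cancel_left_pos)
      ultimately have "u div (2 * t) = 0 \<or> u div (2 * t) = 1 \<or> u div (2 * t) = 2" by linarith
      moreover have "u = 2 * t * (u div (2 * t)) + r" using ur mult_div_mod_eq[of "2 * t" u] by simp
      ultimately show ?thesis by auto
    qed
    then have "X \<subseteq> ?f r" by blast
    moreover have "card (?f r) = card X" using X t by simp
    ultimately have "X = ?f r" by (intro card_subset_eq) simp_all
    then show "X \<in> ?f ` {0..<2 * t}" using r by blast
  next
    fix X assume "X \<in> ?f ` {0..<2 * t}"
    then obtain r where r: "0 \<le> r" "r < 2 * t" "X = ?f r" by auto
    then have "\<Sum>X = 3 * r + 6 * t" using t by simp
    then have "midpoints m X = X" using r by (auto simp: midpoints_def assms)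
    then show "X \<in> ?T" using r t by (auto simp: assms)
  qed
  moreover have "inj_on ?f {0..<2 * t}"
  proof (rule inj_onI)
    fix r s assume r: "r \<in> {0..<2 * t}" and s: "s \<in> {0..<2 * t}" and "?f r = ?f s"
    then have "r \<in> ?f s" by blast
    then show "r = s" using r s by auto
  qed
  ultimately show ?thesis using t by (simp add: card_image)
qed

text \<open>
  Two midpoints \<open>x\<close> and \<open>y\<close> of a set satisfy \<open>3 x \<equiv> 3 y\<close> modulo \<open>2 m\<close>.
\<close>

lemma no_all_midpoints_of_not_3_dvd:
  assumes "\<not> 3 dvd m"
  shows "{X. X \<subseteq> Z \<and> card X = 3 \<and> midpoints m X = X} = {}"
proof -
  have False if X: "X \<subseteq> Z" "card X = 3" "midpoints m X = X" for X
  proof -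
    obtain x y where xy: "x \<in> X" "y \<in> X" "x \<noteq> y" using X(2) by (auto simp: card_3_iff)
    then have "x \<in> midpoints m X" "y \<in> midpoints m X" using X by auto
    then have "2 * m dvd (\<Sum>X - 3 * y) - (\<Sum>X - 3 * x)"
      by (auto simp only: midpoints_def mem_Collect_eq intro!: dvd_diff)
    then have D: "2 * m dvd 3 * (x - y)" by (simp add: algebra_simps)
    have "prime (3::int)" by simp
    then have "coprime 3 m" using assms by (simp add: prime_imp_coprime)
    then have "coprime m 3" by (simp only: coprime_commute)
    moreover have "m dvd 3 * (x - y)" using D by (rule dvd_mult_right)
    ultimately have "m dvd x - y" by (simp only: coprime_dvd_mult_right_iff)
    moreover have "even (x - y)" using D by (auto dest!: dvd_mult_left)
    ultimately have "2 * m dvd x - y" by (simp add: dvd_split)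
    moreover have "x \<in> Z" "y \<in> Z" using xy X(1) by blast+
    ultimately have "x = y" using Z_congruent_iff by blast
    then show False using xy by simp
  qed
  then show ?thesis by blast
qed

lemma mdts_rotations_iff:
  assumes X: "X \<subseteq> Z" "card X = 3"
  shows "product_size m X {} < quotient_size m X {} \<longleftrightarrow> midpoints m X = {}"
proof
  assume "product_size m X {} < quotient_size m X {}"
  then show "midpoints m X = {}" using balanced_of_midpoint[OF X(2)] by (auto simp: midpoints_def)
next
  assume "midpoints m X = {}"
  then have "\<not> 2 * m dvd \<Sum>X - 3 * y" if "y \<in> X" for y using that by (auto simp: midpoints_def)
  moreover have "\<not> 2 * m dvd u - v" if "u \<in> X" "v \<in> X" "u \<noteq> v" for u v
    using that X(1) Z_congruent_iff[of u v] by blast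
  ultimately show "product_size m X {} < quotient_size m X {}" using X(2) by (intro mdts_of_no_midpoint)
qed

lemma not_mstd_rotations:
  assumes "X \<subseteq> Z" "card X = 3"
  shows "\<not> quotient_size m X {} < product_size m X {}"
proof (cases "midpoints m X = {}")
  case True
  then show ?thesis using mdts_rotations_iff[OF assms] by simp
next
  case False
  then show ?thesis using balanced_of_midpoint[OF assms(2)] by (auto simp: midpoints_def)
qed

text \<open>
  By the number of midpoints, the sum over all sets is the number of progressions plus twice the
  number of cosets of the subgroup of order 3.
\<close>

lemma count_mdts_rotations:
  "int (card {X. X \<subseteq> Z \<and> card X = 3 \<and> product_size m X {} < quotient_size m X {}}) =
    int (nat (2 * m) choose 3) - 2 * m * (m - 1) +
    2 * int (card {X. X \<subseteq> Z \<and> card X = 3 \<and> midpoints m X = X})"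
proof -
  let ?F = "{X. X \<subseteq> Z \<and> card X = 3}"
  let ?A = "{X \<in> ?F. midpoints m X \<noteq> {}}"
  have fin: "finite ?F" by simp
  have mdts: "{X. X \<subseteq> Z \<and> card X = 3 \<and> product_size m X {} < quotient_size m X {}} = ?F - ?A"
    using mdts_rotations_iff by blast
  have "(\<Sum>X\<in>?F. card (midpoints m X)) =
      (\<Sum>X\<in>?F. (if midpoints m X = {} then 0 else 1) + (if midpoints m X \<noteq> X then 0 else 2))"
    by (rule sum.cong) (simp_all add: card_midpoints)
  also have "\<dots> = card ?A + card {X \<in> ?F. midpoints m X = X} * 2"
    by (simp only: sum.distrib sum_if_zero[OF fin] not_not) simp
  also have "{X \<in> ?F. midpoints m X = X} = {X. X \<subseteq> Z \<and> card X = 3 \<and> midpoints m X = X}" by auto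
  finally have A: "2 * m * (m - 1) = int (card ?A) + 2 * int (card {X. X \<subseteq> Z \<and> card X = 3 \<and> midpoints m X = X})"
    using sum_card_midpoints by simp
  have "card ?F = nat (2 * m) choose 3" using n_subsets[of Z 3] by simp
  moreover have "card (?F - ?A) = card ?F - card ?A" by (rule card_Diff_subset) auto
  moreover have "card ?A \<le> card ?F" by (rule card_mono) auto
  ultimately show ?thesis unfolding mdts using A by simp
qed

end

section \<open>The counts for the dicyclic group\<close>

lemma card_dic_subsets:
  "card {A. A \<subseteq> carrier (dic_model n) \<and> card A = 3 \<and> Q A} =
    card {(X, Y). X \<subseteq> {0..<2 * int n} \<and> Y \<subseteq> {0..<2 * int n} \<and> card X + card Y = 3 \<and> Q (dic_set X Y)}"
    (is "card ?L = card ?R")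
proof -
  have card: "card (dic_set X Y) = card X + card Y"
    if "X \<subseteq> {0..<2 * int n}" "Y \<subseteq> {0..<2 * int n}" for X Y
    using that finite_subset[OF _ finite_atLeastLessThan_int] by (intro card_dic_set) blast+
  have "bij_betw (\<lambda>(X, Y). dic_set X Y) ?R ?L"
    unfolding bij_betw_def
  proof (intro conjI equalityI subsetI)
    show "inj_on (\<lambda>(X, Y). dic_set X Y) ?R"
      by (auto simp: inj_on_def dic_set_def set_eq_iff)
  next
    fix A assume "A \<in> (\<lambda>(X, Y). dic_set X Y) ` ?R"
    then obtain X Y where "(X, Y) \<in> ?R" "A = dic_set X Y" by auto
    then show "A \<in> ?L" using card[of X Y] by (auto simp: dic_model_carrier dic_set_def)
  next
    fix A assume A: "A \<in> ?L"
    define X Y where "X = {i. (i, False) \<in> A}" and "Y = {i. (i, True) \<in> A}"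
    have XY: "dic_set X Y = A"
    proof (intro Set.set_eqI)
      fix p :: "int \<times> bool"
      show "p \<in> dic_set X Y \<longleftrightarrow> p \<in> A"
        by (cases p; cases "snd p") (auto simp: dic_set_def X_def Y_def)
    qed
    have "X \<subseteq> {0..<2 * int n}" "Y \<subseteq> {0..<2 * int n}"
      using A by (auto simp: X_def Y_def dic_model_carrier)
    then have "(X, Y) \<in> ?R" using A XY card[of X Y] by auto
    then show "A \<in> (\<lambda>(X, Y). dic_set X Y) ` ?R" using XY by (intro image_eqI[of _ _ "(X, Y)"]) auto
  qed
  then show ?thesis by (rule bij_betw_same_card[symmetric])
qed

lemma num_total:
  assumes "finite (carrier G)"
  shows "num_MSTD G k + num_MDTS G k + num_balanced G k = card (carrier G) choose k"
proof -
  let ?A = "{A. A \<subseteq> carrier G \<and> card A = k \<and> MSTD G A}"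
  let ?B = "{A. A \<subseteq> carrier G \<and> card A = k \<and> MDTS G A}"
  let ?C = "{A. A \<subseteq> carrier G \<and> card A = k \<and> balanced G A}"
  have "{A. A \<subseteq> carrier G \<and> card A = k} = ?A \<union> ?B \<union> ?C"
    by (auto simp: MSTD_def MDTS_def balanced_def)
  moreover have "card (?A \<union> ?B \<union> ?C) = card ?A + card ?B + card ?C"
    using assms by (subst card_Un_disjoint; auto simp: MSTD_def MDTS_def balanced_def)+
  ultimately show ?thesis
    using n_subsets[OF assms, of k] by (simp add: num_MSTD_def num_MDTS_def num_balanced_def)
qed

text \<open>
  In the second count the term \<open>6 n (n - 1)\<close> collects the mixed sets: \<open>2 n (n - 1)\<close> with two powers of
  \<open>a\<close> and \<open>4 n (n - 1)\<close> with one. The remaining terms are the sets of powers of \<open>a\<close> that are not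
  progressions.
\<close>

lemma
  assumes "n \<ge> 3" "odd n"
  shows num_MSTD_dic_model: "int (num_MSTD (dic_model n) 3) = 4 * int n * (int n - 1) * (2 * int n - 5)"
    and num_MDTS_dic_model: "int (num_MDTS (dic_model n) 3) =
      int (2 * n choose 3) - 2 * int n * (int n - 1) + 6 * int n * (int n - 1)
      + (if 3 dvd n then 4 * (int n div 3) else 0)"
proof -
  interpret odd_modulus "int n" using assms by unfold_locales simp_all
  let ?Z = "{0..<2 * int n}"
  have fin: "finite X" if "X \<subseteq> ?Z" for X using that finite_subset by blast
  have size: "card (dic_set X Y <#>\<^bsub>dic_model n\<^esub> dic_set X Y) = product_size (int n) X Y"
    "card (dic_set X Y <#>\<^bsub>dic_model n\<^esub> set_inv\<^bsub>dic_model n\<^esub> (dic_set X Y)) = quotient_size (int n) X Y"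
    if "X \<subseteq> ?Z" "Y \<subseteq> ?Z" for X Y
    using that fin assms
    by (simp_all add: product_size_def quotient_size_def card_set_mult_dic_set card_set_diff_dic_set)
  have "num_MSTD (dic_model n) 3 = card {(X, Y). X \<subseteq> ?Z \<and> Y \<subseteq> ?Z \<and> card X + card Y = 3 \<and>
      quotient_size (int n) X Y < product_size (int n) X Y}"
    unfolding num_MSTD_def card_dic_subsets MSTD_def by (metis (lifting) size)
  also have "\<dots> = (\<Sum>z\<in>?Z. card {X. X \<subseteq> ?Z \<and> card X = 2 \<and> quotient_size (int n) X {z} < product_size (int n) X {z}}) +
    (\<Sum>x\<in>?Z. card {Y. Y \<subseteq> ?Z \<and> card Y = 2 \<and> quotient_size (int n) {x} Y < product_size (int n) {x} Y})"
  proof -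
    have "{X. X \<subseteq> ?Z \<and> card X = 3 \<and> quotient_size (int n) X {} < product_size (int n) X {}} = {}"
      using not_mstd_rotations by blast
    then show ?thesis by (subst card_subset_pairs) (simp_all add: balanced_reflections)
  qed
  finally have "2 * int (num_MSTD (dic_model n) 3) =
     (\<Sum>z\<in>?Z. 2 * int (card {X. X \<subseteq> ?Z \<and> card X = 2 \<and> quotient_size (int n) X {z} < product_size (int n) X {z}})) +
    2 * (\<Sum>x\<in>?Z. int (card {Y. Y \<subseteq> ?Z \<and> card Y = 2 \<and> quotient_size (int n) {x} Y < product_size (int n) {x} Y}))"
    by (simp add: sum_distrib_left)
  also have "\<dots> = (\<Sum>z\<in>?Z. (2 * int n - 2) * (2 * int n - 5)) +
      2 * (\<Sum>x\<in>?Z. if int n dvd x then 0 else int n * (2 * int n - 5))"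
    by (simp only: count_mstd_two_rotations count_mstd_two_reflections)
  also have "(\<Sum>x\<in>?Z. if int n dvd x then 0 else int n * (2 * int n - 5)) =
      (2 * int n - 2) * (int n * (2 * int n - 5))"
    by (subst sum_if_zero) (simp_all only: finite_atLeastLessThan_int of_nat_id int_eq_iff of_int_of_nat_eq card_not_dvd0)
  finally show "int (num_MSTD (dic_model n) 3) = 4 * int n * (int n - 1) * (2 * int n - 5)"
    by (simp add: algebra_simps)
  have "num_MDTS (dic_model n) 3 = card {(X, Y). X \<subseteq> ?Z \<and> Y \<subseteq> ?Z \<and> card X + card Y = 3 \<and>
      product_size (int n) X Y < quotient_size (int n) X Y}"
    unfolding num_MDTS_def card_dic_subsets MDTS_def by (metis (lifting) size)
  also have "\<dots> = card {X. X \<subseteq> ?Z \<and> card X = 3 \<and> product_size (int n) X {} < quotient_size (int n) X {}} +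
    (\<Sum>z\<in>?Z. card {X. X \<subseteq> ?Z \<and> card X = 2 \<and> product_size (int n) X {z} < quotient_size (int n) X {z}}) +
    (\<Sum>x\<in>?Z. card {Y. Y \<subseteq> ?Z \<and> card Y = 2 \<and> product_size (int n) {x} Y < quotient_size (int n) {x} Y})"
    by (subst card_subset_pairs) (simp_all add: balanced_reflections)
  finally have "int (num_MDTS (dic_model n) 3) =
    int (card {X. X \<subseteq> ?Z \<and> card X = 3 \<and> product_size (int n) X {} < quotient_size (int n) X {}}) +
    (\<Sum>z\<in>?Z. int (card {X. X \<subseteq> ?Z \<and> card X = 2 \<and> product_size (int n) X {z} < quotient_size (int n) X {z}})) +
    (\<Sum>x\<in>?Z. int (card {Y. Y \<subseteq> ?Z \<and> card Y = 2 \<and> product_size (int n) {x} Y < quotient_size (int n) {x} Y}))"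
    by simp
  also have "(\<Sum>z\<in>?Z. int (card {X. X \<subseteq> ?Z \<and> card X = 2 \<and> product_size (int n) X {z} < quotient_size (int n) X {z}})) =
      2 * int n * (int n - 1)"
    by (simp add: count_mdts_two_rotations)
  also have "(\<Sum>x\<in>?Z. int (card {Y. Y \<subseteq> ?Z \<and> card Y = 2 \<and> product_size (int n) {x} Y < quotient_size (int n) {x} Y})) =
      2 * (int n * (2 * int n - 2))"
  proof -
    have "int (card {x \<in> ?Z. int n dvd x}) = 2"
    proof -
      have "card ?Z = card {x \<in> ?Z. int n dvd x} + card {x \<in> ?Z. \<not> int n dvd x}"
      proof -
        have "{x \<in> ?Z. int n dvd x} = ?Z \<inter> {x. int n dvd x}"
          "{x \<in> ?Z. \<not> int n dvd x} = ?Z - {x. int n dvd x}" by auto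
        then show ?thesis by (simp only: card_Int_Diff[OF finite_atLeastLessThan_int])
      qed
      then show ?thesis using card_not_dvd0 by simp
    qed
    moreover have "(\<Sum>x\<in>?Z. if int n dvd x then int n * (2 * int n - 2) else 0) =
        (\<Sum>x\<in>?Z. if \<not> int n dvd x then 0 else int n * (2 * int n - 2))"
      by (rule sum.cong) auto
    ultimately show ?thesis
      by (simp only: count_mdts_two_reflections sum_if_zero[OF finite_atLeastLessThan_int] not_not of_nat_id)
  qed
  also have "int (card {X. X \<subseteq> ?Z \<and> card X = 3 \<and> product_size (int n) X {} < quotient_size (int n) X {}}) =
      int (2 * n choose 3) - 2 * int n * (int n - 1) + (if 3 dvd n then 4 * (int n div 3) else 0)"
  proof (cases "3 dvd n")
    case True
    then obtain t where "n = 3 * t" by blast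
    then show ?thesis using True card_all_midpoints_of_3_dvd[of "int t"] count_mdts_rotations by (simp add: nat_mult_distrib)
  next
    case False
    then have "\<not> 3 dvd int n" by presburger
    then show ?thesis using False no_all_midpoints_of_not_3_dvd count_mdts_rotations by (simp add: nat_mult_distrib)
  qed
  finally show "int (num_MDTS (dic_model n) 3) =
      int (2 * n choose 3) - 2 * int n * (int n - 1) + 6 * int n * (int n - 1)
      + (if 3 dvd n then 4 * (int n div 3) else 0)"
    by (simp add: algebra_simps)
qed

theorem theorem1p6:
  fixes n :: nat
  assumes "n \<ge> 3" and "odd n"
  shows "(3 dvd n \<longrightarrow>
            real (num_MSTD (dicyclic_group n) 3) = 4 * real n * (real n - 1) * (2 * real n - 5) \<and>
            real (num_MDTS (dicyclic_group n) 3)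
              = 2 * real n * (2 * (real n)\<^sup>2 + 3 * real n - 3) / 3 \<and>
            real (num_balanced (dicyclic_group n) 3)
              = 2 * real n * (2 * (real n)\<^sup>2 + 27 * real n - 25) / 3) \<and>
         (\<not> 3 dvd n \<longrightarrow>
            real (num_MSTD (dicyclic_group n) 3) = 4 * real n * (real n - 1) * (2 * real n - 5) \<and>
            real (num_MDTS (dicyclic_group n) 3)
              = 2 * real n * (real n - 1) * (2 * real n + 5) / 3 \<and>
            real (num_balanced (dicyclic_group n) 3)
              = 2 * real n * (2 * (real n)\<^sup>2 + 27 * real n - 23) / 3)"
proof -
  have n: "n > 0" using assms by simp
  have "group (dicyclic_group n)" unfolding dicyclic_group_def by (rule group_presented)
  with dic_model_iso[OF n] group_dic_model[OF n]
  have counts: "num_MSTD (dicyclic_group n) 3 = num_MSTD (dic_model n) 3"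
    "num_MDTS (dicyclic_group n) 3 = num_MDTS (dic_model n) 3"
    "num_balanced (dicyclic_group n) 3 = num_balanced (dic_model n) 3"
    using num_MSTD_iso num_MDTS_iso num_balanced_iso by metis+
  define r where "r = real n"
  have S: "real (num_MSTD (dic_model n) 3) = 4 * r * (r - 1) * (2 * r - 5)"
    using num_MSTD_dic_model[OF assms, THEN arg_cong[of _ _ real_of_int]] by (simp add: r_def)
  have ch: "real (k choose 3) = real k * (real k - 1) * (real k - 2) / 6" for k
    using six_choose_three[of k, THEN arg_cong[of _ _ real_of_int]] by simp
  have div3: "real_of_int (int n div 3) = r / 3" if "3 dvd n" using that by (auto simp: r_def)
  have D: "real (num_MDTS (dic_model n) 3) = 2 * r * (2 * r - 1) * (2 * r - 2) / 6 + 4 * r * (r - 1)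
      + (if 3 dvd n then 4 * r / 3 else 0)"
    using num_MDTS_dic_model[OF assms, THEN arg_cong[of _ _ real_of_int]] div3
    by (simp add: ch r_def algebra_simps)
  \<comment> \<open>The balanced sets are what remains of all three-element subsets.\<close>
  have "card (carrier (dic_model n)) = 4 * n"
    by (simp add: dic_model_carrier card_cartesian_product nat_mult_distrib)
  moreover have "finite (carrier (dic_model n))" by (simp add: dic_model_carrier)
  ultimately have "real (num_MSTD (dic_model n) 3) + real (num_MDTS (dic_model n) 3) +
      real (num_balanced (dic_model n) 3) = 4 * r * (4 * r - 1) * (4 * r - 2) / 6"
    using num_total[of "dic_model n" 3, THEN arg_cong[of _ _ real]] by (simp add: ch r_def)
  then have B: "real (num_balanced (dic_model n) 3) = 4 * r * (4 * r - 1) * (4 * r - 2) / 6 -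
      real (num_MSTD (dic_model n) 3) - real (num_MDTS (dic_model n) 3)" by linarith
  show ?thesis
    unfolding counts B S D r_def[symmetric] by (simp add: field_simps power2_eq_square)
qed

end
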